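(* Let $\mathcal M_A,\mathcal M_B$ be commuting von Neumann algebras on a Hilbert space $\mathcal H$ (the observable algebras of two agents, Alice and Bob). The following two properties are equivalent: (B2) Duality: Alice can implement all operations that commute with all of Bob's operations, and vice versa (with the roles of Alice and Bob exchanged). (B3) Uniqueness of purifications: if $\Psi,\Phi\in\mathcal H$ are unit vectors inducing the same marginal state on $\mathcal M_A$, i.e. $\langle\Psi,a\Psi\rangle=\langle\Phi,a\Phi\rangle$ for all $a\in\mathcal M_A$, then there is a partial isometry $v_B\in\mathcal M_B$ such that $\Psi=v_B\Phi$. Moreover, they hold if and only if $\mathcal M_A=\mathcal M_B'$.
   Context: Hilbert spaces are separable; $\mathcal R'$ denotes the commutant in $B(\mathcal H)$. An operation on $\mathcal H$ is an instrument, i.e. a countable family $(T_x)$ of normal completely positive maps on $B(\mathcal H)$ (Heisenberg picture) such that $\sum_xT_x$ is unital. For a von Neumann algebra $\mathcal M$ on $\mathcal H$, an instrument is $\mathcal M$-inner if each $T_x$ has the form $T_x=\sum_yk_{y|x}^*(\,\cdot\,)k_{y|x}$ with $k_{y|x}\in\mathcal M$. The operations that Alice (Bob) can implement are exactly the $\mathcal M_A$-inner ($\mathcal M_B$-inner) ones. Two instruments $(T_x)$, $(S_y)$ commute if $T_x\circ S_y=S_y\circ T_x$ for all $x,y$. *)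

theory Defs
  imports "HOL-Analysis.Analysis"
begin

section \<open>Complex Hilbert spaces\<close>

class complex_vector = ab_group_add +
  fixes scaleC :: "complex \<Rightarrow> 'a \<Rightarrow> 'a"  (infixr \<open>*\<^sub>C\<close> 75)
  assumes scaleC_add_right: "c *\<^sub>C (x + y) = c *\<^sub>C x + c *\<^sub>C y"
    and scaleC_add_left: "(c + d) *\<^sub>C x = c *\<^sub>C x + d *\<^sub>C x"
    and scaleC_scaleC: "c *\<^sub>C d *\<^sub>C x = (c * d) *\<^sub>C x"
    and scaleC_one: "1 *\<^sub>C x = x"

text \<open>
  The norm and the topology are those of the underlying real inner product space. Since the real
  inner product is required to be the real part of \<open>cinner\<close>, the norm is the one
  induced by \<open>cinner\<close>. The inner product is linear in its second argument.
\<close>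

class complex_hilbert = real_inner + complete_space + complex_vector +
  fixes cinner :: "'a \<Rightarrow> 'a \<Rightarrow> complex"
  assumes scaleR_scaleC: "r *\<^sub>R x = complex_of_real r *\<^sub>C x"
    and cinner_commute: "cinner x y = cnj (cinner y x)"
    and cinner_add_right: "cinner x (y + z) = cinner x y + cinner x z"
    and cinner_scaleC_right: "cinner x (c *\<^sub>C y) = c * cinner x y"
    and inner_eq_Re_cinner: "inner x y = Re (cinner x y)"

lemma scaleC_zero_right: "c *\<^sub>C 0 = 0"
  for c :: complex
  using scaleC_add_right[of c 0 0] by simp

lemma scaleC_minus_right: "c *\<^sub>C (- x) = - (c *\<^sub>C x)"
  using scaleC_add_right[of c x "- x"]
  by (simp add: scaleC_zero_right eq_neg_iff_add_eq_0 add.commute)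

lemma scaleC_diff_right: "c *\<^sub>C (x - y) = c *\<^sub>C x - c *\<^sub>C y"
  using scaleC_add_right[of c x "- y"] by (simp add: scaleC_minus_right)

lemma cinner_add_left: "cinner (x + y) z = cinner x z + cinner y z"
  for x y z :: "'h::complex_hilbert"
  by (simp add: cinner_commute[of "x + y" z] cinner_commute[of x z] cinner_commute[of y z]
      cinner_add_right)

lemma cinner_scaleC_left: "cinner (c *\<^sub>C x) y = cnj c * cinner x y"
  for x y :: "'h::complex_hilbert"
  by (simp add: cinner_commute[of "c *\<^sub>C x" y] cinner_commute[of x y] cinner_scaleC_right)

lemma cinner_self: "cinner x x = complex_of_real ((norm x)\<^sup>2)"
  for x :: "'h::complex_hilbert"
proof -
  have "Im (cinner x x) = 0"
    using arg_cong[OF cinner_commute[of x x], of Im] by simp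
  moreover have "Re (cinner x x) = (norm x)\<^sup>2"
    by (simp add: inner_eq_Re_cinner[symmetric] power2_norm_eq_inner)
  ultimately show ?thesis
    by (simp add: complex_eq_iff)
qed

lemma cinner_eq_inner:
  "cinner x y = Complex (inner x y) (- inner x (\<i> *\<^sub>C y))"
  for x y :: "'h::complex_hilbert"
  by (simp add: inner_eq_Re_cinner cinner_scaleC_right complex_eq_iff)

lemma norm_scaleC: "norm (c *\<^sub>C x) = cmod c * norm x"
  for x :: "'h::complex_hilbert"
proof -
  have "complex_of_real ((norm (c *\<^sub>C x))\<^sup>2) = cnj c * c * complex_of_real ((norm x)\<^sup>2)"
    unfolding cinner_self[symmetric]
    by (simp add: cinner_scaleC_right cinner_scaleC_left)
  also have "\<dots> = complex_of_real ((cmod c * norm x)\<^sup>2)"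
    by (simp add: power_mult_distrib complex_norm_square mult_ac flip: of_real_power)
  finally have "(norm (c *\<^sub>C x))\<^sup>2 = (cmod c * norm x)\<^sup>2"
    using of_real_eq_iff by blast
  then show ?thesis
    by (simp add: power2_eq_iff_nonneg)
qed


section \<open>The algebra of bounded operators\<close>

typedef (overloaded) 'h bdd_op =
  "{a :: 'h::complex_hilbert \<Rightarrow> 'h. bounded_linear a \<and> (\<forall>c x. a (c *\<^sub>C x) = c *\<^sub>C a x)}"
  morphisms op_apply Bdd_op
  by (intro exI[of _ "\<lambda>x. x"]) simp

notation op_apply (infixr \<open>\<cdot>\<close> 72)

setup_lifting type_definition_bdd_op

lemma bdd_op_eqI: "(\<And>x. a \<cdot> x = b \<cdot> x) \<Longrightarrow> a = b"
  by (metis ext op_apply_inject)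

instantiation bdd_op :: (complex_hilbert) "{ring, monoid_mult, complex_vector}"
begin

lift_definition zero_bdd_op :: "'a bdd_op" is "\<lambda>x. 0"
  by (simp add: scaleC_zero_right)

lift_definition one_bdd_op :: "'a bdd_op" is "\<lambda>x. x"
  by simp

lift_definition plus_bdd_op :: "'a bdd_op \<Rightarrow> 'a bdd_op \<Rightarrow> 'a bdd_op" is "\<lambda>a b x. a x + b x"
  by (simp add: bounded_linear_add scaleC_add_right)

lift_definition uminus_bdd_op :: "'a bdd_op \<Rightarrow> 'a bdd_op" is "\<lambda>a x. - a x"
  by (simp add: bounded_linear_minus scaleC_minus_right)

lift_definition minus_bdd_op :: "'a bdd_op \<Rightarrow> 'a bdd_op \<Rightarrow> 'a bdd_op" is "\<lambda>a b x. a x - b x"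
  by (simp add: bounded_linear_sub scaleC_diff_right)

lift_definition times_bdd_op :: "'a bdd_op \<Rightarrow> 'a bdd_op \<Rightarrow> 'a bdd_op" is "\<lambda>a b x. a (b x)"
  by (simp add: bounded_linear_compose)

lift_definition scaleC_bdd_op :: "complex \<Rightarrow> 'a bdd_op \<Rightarrow> 'a bdd_op" is "\<lambda>c a x. c *\<^sub>C a x"
proof (intro conjI allI)
  fix c :: complex and a :: "'a \<Rightarrow> 'a"
  assume a: "bounded_linear a \<and> (\<forall>c x. a (c *\<^sub>C x) = c *\<^sub>C a x)"
  have "bounded_linear (\<lambda>y::'a. c *\<^sub>C y)"
    by (rule bounded_linear_intro[where K = "cmod c"])
      (simp_all add: scaleC_add_right scaleR_scaleC scaleC_scaleC norm_scaleC mult.commute)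
  then show "bounded_linear (\<lambda>x. c *\<^sub>C a x)"
    using a bounded_linear_compose by blast
  show "c *\<^sub>C a (d *\<^sub>C x) = d *\<^sub>C c *\<^sub>C a x" for d x
    using a by (simp add: scaleC_scaleC mult.commute)
qed

instance
proof
  fix a b c :: "'a bdd_op" and r s :: complex
  show "a + b + c = a + (b + c)" "a + b = b + a" "0 + a = a" "- a + a = 0" "a - b = a + - b"
    by (transfer; simp add: fun_eq_iff algebra_simps)+
  show "a * b * c = a * (b * c)" "1 * a = a" "a * 1 = a" "(a + b) * c = a * c + b * c"
    by (transfer; simp add: fun_eq_iff)+
  show "a * (b + c) = a * b + a * c"
    by transfer (simp add: fun_eq_iff linear_simps)
  show "r *\<^sub>C (a + b) = r *\<^sub>C a + r *\<^sub>C b" "(r + s) *\<^sub>C a = r *\<^sub>C a + s *\<^sub>C a"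
    "r *\<^sub>C s *\<^sub>C a = (r * s) *\<^sub>C a" "1 *\<^sub>C a = a"
    by (transfer; simp add: fun_eq_iff scaleC_add_right scaleC_add_left scaleC_scaleC scaleC_one)+
qed

end

lemma op_apply_bounded_linear: "bounded_linear (op_apply a)"
  using op_apply[of a] by simp

lemma op_apply_scaleC: "a \<cdot> c *\<^sub>C x = c *\<^sub>C (a \<cdot> x)"
  using op_apply[of a] by simp

lemma op_apply_add: "a \<cdot> (x + y) = a \<cdot> x + a \<cdot> y"
  using op_apply_bounded_linear[of a] by (simp add: linear_simps)

definition adj :: "'h::complex_hilbert bdd_op \<Rightarrow> 'h bdd_op" where
  "adj a = (THE b. \<forall>x y. cinner (b \<cdot> x) y = cinner x (a \<cdot> y))"

text \<open>
  The Riesz representation theorem guarantees that the description in the definition of \<open>adj\<close>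
  is satisfied by exactly one operator.
\<close>

lemma riesz_real:
  fixes g :: "'h::{real_inner, complete_space} \<Rightarrow> real"
  assumes "bounded_linear g"
  shows "\<exists>z. \<forall>x. g x = inner z x"
proof -
  interpret g: bounded_linear g by fact
  obtain K where K: "\<And>x. \<bar>g x\<bar> \<le> norm x * K"
    using g.bounded by auto
  define J where "J x = (norm x)\<^sup>2 - 2 * g x" for x
  have J_lower: "- K\<^sup>2 \<le> J x" for x
  proof -
    have "0 \<le> (norm x - K)\<^sup>2" by simp
    then show ?thesis
      using K[of x] by (simp add: J_def power2_eq_square algebra_simps)
  qed
  then have bdd: "bdd_below (range J)"
    by (meson bdd_belowI2)
  define m where "m = Inf (range J)"
  have m_le: "m \<le> J x" for x
    unfolding m_def by (rule cInf_lower[OF _ bdd]) simp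
  have "\<exists>x. J x < m + inverse (real (Suc n))" for n
    using cInf_lessD[of "range J" "m + inverse (real (Suc n))"] by (auto simp: m_def)
  then obtain X where X: "\<And>n. J (X n) < m + inverse (real (Suc n))"
    by metis
  have gap: "(norm (x - y))\<^sup>2 \<le> 2 * (J x - m) + 2 * (J y - m)" for x y
  proof -
    have "(norm (x - y))\<^sup>2 = 2 * J x + 2 * J y - 4 * J ((1/2) *\<^sub>R (x + y))"
      by (simp add: J_def g.scaleR g.add power2_norm_eq_inner inner_diff_left inner_diff_right
          inner_add_left inner_add_right inner_commute[of y x] algebra_simps
          power_divide add_divide_distrib del: scaleR_add_right)
    moreover have "4 * m \<le> 4 * J ((1/2) *\<^sub>R (x + y))"
      by (intro mult_left_mono m_le) simp
    ultimately have "(norm (x - y))\<^sup>2 \<le> 2 * J x + 2 * J y - 4 * m"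
      by (metis diff_left_mono)
    then show ?thesis
      by (simp add: algebra_simps)
  qed
  have "Cauchy X"
  proof (rule metric_CauchyI)
    fix e :: real
    assume e: "0 < e"
    obtain N where N: "inverse (real (Suc N)) < e\<^sup>2 / 4"
      using reals_Archimedean[of "e\<^sup>2 / 4"] e by auto
    have X_N: "J (X i) < m + e\<^sup>2 / 4" if "N \<le> i" for i
    proof -
      have "inverse (real (Suc i)) \<le> inverse (real (Suc N))"
        using that by (auto intro!: le_imp_inverse_le)
      then have "m + inverse (real (Suc i)) \<le> m + e\<^sup>2 / 4"
        using N by (intro add_left_mono) (rule order_trans[OF _ less_imp_le])
      with X[of i] show ?thesis
        by (rule less_le_trans)
    qed
    have "dist (X i) (X j) < e" if "N \<le> i" "N \<le> j" for i j
    proof -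
      have "2 * (J (X i) - m) + 2 * (J (X j) - m) < e\<^sup>2"
        using X_N[OF that(1)] X_N[OF that(2)] by simp
      with gap[of "X i" "X j"] have "(norm (X i - X j))\<^sup>2 < e\<^sup>2"
        by (rule le_less_trans)
      then show ?thesis
        using e by (simp add: dist_norm power_less_imp_less_base)
    qed
    then show "\<exists>M. \<forall>i\<ge>M. \<forall>j\<ge>M. dist (X i) (X j) < e" by blast
  qed
  then obtain z where z: "X \<longlonglongrightarrow> z"
    using Cauchy_convergent convergent_def by blast
  have "(\<lambda>n. J (X n)) \<longlonglongrightarrow> J z"
    unfolding J_def by (intro tendsto_intros g.tendsto z)
  moreover have "(\<lambda>n. m + inverse (real (Suc n))) \<longlonglongrightarrow> m + 0"
    by (intro tendsto_intros LIMSEQ_inverse_real_of_nat)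
  ultimately have "J z \<le> m + 0"
    by (rule LIMSEQ_le) (intro exI allI impI less_imp_le X)
  then have Jz: "J z \<le> m"
    by simp
  have "g x = inner z x" for x
  proof -
    define d where "d = inner z x - g x"
    have quad: "0 \<le> t * (t * (norm x)\<^sup>2 + 2 * d)" for t
    proof -
      have "J (z + t *\<^sub>R x) - J z = t * (t * (norm x)\<^sup>2 + 2 * d)"
        by (simp add: J_def d_def g.scaleR g.add power2_norm_eq_inner
            inner_add_left inner_add_right inner_commute[of x z] algebra_simps)
      moreover have "J z \<le> J (z + t *\<^sub>R x)"
        using Jz m_le by (rule order_trans)
      ultimately show ?thesis
        by simp
    qed
    have "d = 0"
    proof (rule ccontr)
      assume "d \<noteq> 0"
      define s where "s = 1 + (norm x)\<^sup>2"
      have s: "0 < s" "(norm x)\<^sup>2 / s < 1"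
        by (auto simp: s_def divide_less_eq add_pos_nonneg)
      have "0 \<le> (- d / s) * ((- d / s) * (norm x)\<^sup>2 + 2 * d)"
        by (rule quad)
      also have "\<dots> = (d\<^sup>2 / s) * ((norm x)\<^sup>2 / s - 2)"
        by (simp add: power2_eq_square algebra_simps)
      also have "\<dots> < 0"
        using \<open>d \<noteq> 0\<close> s(1)
        by (intro mult_pos_neg order.strict_trans[OF diff_strict_right_mono[OF s(2)]]) simp_all
      finally show False
        by simp
    qed
    then show ?thesis by (simp add: d_def)
  qed
  then show ?thesis by blast
qed

lemma adj_exists: "\<exists>b. \<forall>x y. cinner (b \<cdot> x) y = cinner x (a \<cdot> y)"
  for a :: "'h::complex_hilbert bdd_op"
proof -
  have bl: "bounded_linear (\<lambda>y. inner x (a \<cdot> y))" for x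
    by (intro bounded_linear_inner_right_comp op_apply_bounded_linear)
  obtain f where f: "\<And>x y. inner x (a \<cdot> y) = inner (f x) y"
    using riesz_real[OF bl] by metis
  have c: "cinner (f x) y = cinner x (a \<cdot> y)" for x y
    by (simp add: cinner_eq_inner op_apply_scaleC[symmetric] f)
  have eqI: "u = v" if "\<And>y. cinner u y = cinner v y" for u v :: 'h
    using that by (metis inner_eq_Re_cinner vector_eq_rdot)
  have fadd: "f (x + y) = f x + f y" for x y
    by (rule eqI) (simp add: c cinner_add_left)
  have fscale: "f (r *\<^sub>C x) = r *\<^sub>C f x" for r x
    by (rule eqI) (simp add: c cinner_scaleC_left)
  obtain K where K: "\<And>x. norm (a \<cdot> x) \<le> norm x * K" and "K > 0"
    using bounded_linear.pos_bounded[OF op_apply_bounded_linear] by blast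
  have "norm (f x) \<le> norm x * K" for x
  proof -
    have "norm (f x) * norm (f x) = inner x (a \<cdot> f x)"
      by (simp add: f power2_norm_eq_inner flip: power2_eq_square)
    also have "\<dots> \<le> norm x * (norm (f x) * K)"
      by (meson K mult_left_mono norm_cauchy_schwarz norm_ge_zero order_trans)
    finally have "norm (f x) * norm (f x) \<le> norm (f x) * (norm x * K)"
      by (simp add: mult_ac)
    then show ?thesis
      using \<open>K > 0\<close> by (cases "f x = 0") (simp_all add: mult_le_cancel_left)
  qed
  then have "bounded_linear f"
    by (intro bounded_linear_intro[where K = K]) (simp_all add: fadd fscale scaleR_scaleC)
  then have "op_apply (Bdd_op f) = f"
    by (simp add: Bdd_op_inverse fscale)
  then show ?thesis
    using c by metis
qed

lemma adj_cinner: "cinner (adj a \<cdot> x) y = cinner x (a \<cdot> y)"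
  for a :: "'h::complex_hilbert bdd_op"
proof -
  have "\<exists>!b. \<forall>x y. cinner (b \<cdot> x) y = cinner x (a \<cdot> y)"
  proof (rule ex_ex1I)
    show "b = b'" if "\<forall>x y. cinner (b \<cdot> x) y = cinner x (a \<cdot> y)"
      "\<forall>x y. cinner (b' \<cdot> x) y = cinner x (a \<cdot> y)" for b b'
      using that by (metis bdd_op_eqI inner_eq_Re_cinner vector_eq_rdot)
  qed (rule adj_exists)
  from theI'[OF this] show ?thesis
    unfolding adj_def by blast
qed

text \<open>A partial isometry is isometric on the orthogonal complement of its kernel.\<close>

definition partial_isometry :: "'h::complex_hilbert bdd_op \<Rightarrow> bool" where
  "partial_isometry v \<longleftrightarrow>
     (\<forall>x. (\<forall>y. v \<cdot> y = 0 \<longrightarrow> cinner y x = 0) \<longrightarrow> norm (v \<cdot> x) = norm x)"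


section \<open>Von Neumann algebras\<close>

definition commutant :: "'h::complex_hilbert bdd_op set \<Rightarrow> 'h bdd_op set" where
  "commutant M = {b. \<forall>a\<in>M. a * b = b * a}"

definition star_subalgebra :: "'h::complex_hilbert bdd_op set \<Rightarrow> bool" where
  "star_subalgebra M \<longleftrightarrow>
     0 \<in> M \<and> (\<forall>a\<in>M. \<forall>b\<in>M. a + b \<in> M) \<and> (\<forall>c. \<forall>a\<in>M. c *\<^sub>C a \<in> M) \<and>
     (\<forall>a\<in>M. \<forall>b\<in>M. a * b \<in> M) \<and> (\<forall>a\<in>M. adj a \<in> M)"

definition von_neumann_algebra :: "'h::complex_hilbert bdd_op set \<Rightarrow> bool" where
  "von_neumann_algebra M \<longleftrightarrow> star_subalgebra M \<and> commutant (commutant M) = M"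


section \<open>Instruments\<close>

text \<open>
  The ultraweak (\<open>\<sigma>\<close>-weak) topology on the bounded operators is the initial topology of
  the functionals \<open>a \<mapsto> \<Sum>n. \<langle>\<phi>\<^sub>n, a \<psi>\<^sub>n\<rangle>\<close> with square-summable sequences of vectors.
\<close>

definition ultraweak_topology :: "'h::complex_hilbert bdd_op topology" where
  "ultraweak_topology = topology_generated_by
     {(\<lambda>a. \<Sum>n. cinner (\<phi> n) (a \<cdot> \<psi> n)) -` U |\<phi> \<psi> U.
        summable (\<lambda>n::nat. (norm (\<phi> n))\<^sup>2) \<and> summable (\<lambda>n. (norm (\<psi> n))\<^sup>2) \<and> open U}"

definition normal_map :: "('h::complex_hilbert bdd_op \<Rightarrow> 'h bdd_op) \<Rightarrow> bool" where
  "normal_map T \<longleftrightarrow> continuous_map ultraweak_topology ultraweak_topology T"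

text \<open>
  \<open>positive_matrix n a\<close> says that the matrix \<open>(a i j)\<^bsub>i,j<n\<^esub>\<close> is a positive operator on the
  \<open>n\<close>-fold direct sum of the Hilbert space.
\<close>

definition positive_matrix :: "nat \<Rightarrow> (nat \<Rightarrow> nat \<Rightarrow> 'h::complex_hilbert bdd_op) \<Rightarrow> bool" where
  "positive_matrix n a \<longleftrightarrow>
     (\<forall>\<psi>. (\<Sum>i<n. \<Sum>j<n. cinner (\<psi> i) (a i j \<cdot> \<psi> j)) \<in> \<real>\<^sub>\<ge>\<^sub>0)"

definition completely_positive :: "('h::complex_hilbert bdd_op \<Rightarrow> 'h bdd_op) \<Rightarrow> bool" where
  "completely_positive T \<longleftrightarrow> Vector_Spaces.linear scaleC scaleC T \<and>
     (\<forall>n a. positive_matrix n a \<longrightarrow> positive_matrix n (\<lambda>i j. T (a i j)))"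

text \<open>
  Infinite sums of operators are taken in the weak operator topology. For the sums below, whose
  partial sums are increasing on positive operators, this is the same as convergence in the strong
  operator or the ultraweak topology.
\<close>

definition op_has_sum :: "('i \<Rightarrow> 'h::complex_hilbert bdd_op) \<Rightarrow> 'h bdd_op \<Rightarrow> 'i set \<Rightarrow> bool" where
  "op_has_sum f s I \<longleftrightarrow>
     (\<forall>\<phi> \<psi>. ((\<lambda>i. cinner \<phi> (f i \<cdot> \<psi>)) has_sum cinner \<phi> (s \<cdot> \<psi>)) I)"

text \<open>
  A countable family of maps is indexed by a set \<open>X\<close> of natural numbers, which may be finite or
  infinite.
\<close>

definition instrument :: "nat set \<Rightarrow> (nat \<Rightarrow> 'h::complex_hilbert bdd_op \<Rightarrow> 'h bdd_op) \<Rightarrow> bool" where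
  "instrument X T \<longleftrightarrow>
     (\<forall>x\<in>X. completely_positive (T x) \<and> normal_map (T x)) \<and> op_has_sum (\<lambda>x. T x 1) 1 X"

definition inner_instrument ::
  "'h::complex_hilbert bdd_op set \<Rightarrow> nat set \<Rightarrow> (nat \<Rightarrow> 'h bdd_op \<Rightarrow> 'h bdd_op) \<Rightarrow> bool" where
  "inner_instrument M X T \<longleftrightarrow> instrument X T \<and>
     (\<forall>x\<in>X. \<exists>(Y :: nat set) k. (\<forall>y\<in>Y. k y \<in> M) \<and>
        (\<forall>a. op_has_sum (\<lambda>y. adj (k y) * a * k y) (T x a) Y))"

definition instruments_commute ::
  "nat set \<Rightarrow> (nat \<Rightarrow> 'h::complex_hilbert bdd_op \<Rightarrow> 'h bdd_op) \<Rightarrow>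
   nat set \<Rightarrow> (nat \<Rightarrow> 'h bdd_op \<Rightarrow> 'h bdd_op) \<Rightarrow> bool" where
  "instruments_commute X T Y S \<longleftrightarrow> (\<forall>x\<in>X. \<forall>y\<in>Y. T x \<circ> S y = S y \<circ> T x)"


section \<open>Duality and uniqueness of purifications\<close>

definition can_implement_commuting ::
  "'h::complex_hilbert bdd_op set \<Rightarrow> 'h bdd_op set \<Rightarrow> bool" where
  "can_implement_commuting M N \<longleftrightarrow>
     (\<forall>X T. instrument X T \<and>
        (\<forall>Y S. inner_instrument N Y S \<longrightarrow> instruments_commute X T Y S) \<longrightarrow>
        inner_instrument M X T)"

definition operational_duality ::
  "'h::complex_hilbert bdd_op set \<Rightarrow> 'h bdd_op set \<Rightarrow> bool" where
  "operational_duality MA MB \<longleftrightarrow>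
     can_implement_commuting MA MB \<and> can_implement_commuting MB MA"

definition unique_purifications ::
  "'h::complex_hilbert bdd_op set \<Rightarrow> 'h bdd_op set \<Rightarrow> bool" where
  "unique_purifications MA MB \<longleftrightarrow>
     (\<forall>\<Psi> \<Phi>. norm \<Psi> = 1 \<and> norm \<Phi> = 1 \<and>
        (\<forall>a\<in>MA. cinner \<Psi> (a \<cdot> \<Psi>) = cinner \<Phi> (a \<cdot> \<Phi>)) \<longrightarrow>
        (\<exists>v\<in>MB. partial_isometry v \<and> \<Psi> = v \<cdot> \<Phi>))"

end

theory Submission
  imports Defs
begin

text \<open>
  Given \<open>M\<^sub>A = M\<^sub>B'\<close>, the map \<open>a \<Phi> \<mapsto> a \<Psi>\<close> extends to a partial isometry in \<open>M\<^sub>A' = M\<^sub>B\<close>. An operation that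
  commutes with all \<open>M\<^sub>B\<close>-inner ones is a module map over \<open>M\<^sub>B\<close>, so its Kraus operators commute with \<open>M\<^sub>B\<close>.
  The Kraus operators of a normal completely positive map \<open>T\<close> come from a Cholesky decomposition of
  the kernel \<open>\<langle>\<phi>, T(|\<xi>\<rangle>\<langle>\<eta>|) \<psi>\<rangle>\<close>, with pivots running through a countable dense set; normality extends
  the decomposition from finite rank operators to all operators.

  Conversely, duality makes conjugation by a unitary \<open>u \<in> M\<^sub>B'\<close> an \<open>M\<^sub>A\<close>-inner operation, which forces
  \<open>u\<close> to commute with \<open>M\<^sub>A'\<close>. Uniqueness of purifications makes every unitary \<open>u \<in> M\<^sub>A'\<close> agree on each
  vector with some element of \<open>M\<^sub>B\<close>, so \<open>u\<close> commutes with the projections in \<open>M\<^sub>B'\<close> and lies in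
  \<open>M\<^sub>B'' = M\<^sub>B\<close>. A commutant is the span of its unitaries, and commuting with its projections
  suffices to commute with all of it.
\<close>

subsection \<open>Operators and the complex inner product\<close>

text \<open>Uniqueness of purifications only says that \<open>u\<close> agrees at each vector with
  some element of \<open>M\<^sub>B\<close>, and that element changes with the vector. What survives
  is that \<open>u\<close> preserves the closed subspaces that are ranges of projections in
  \<open>M\<^sub>B'\<close>; hence projections are the natural test objects. Passing from them to
  the whole commutant is usually the spectral theorem; a repeated halving, costing one square root
  and one kernel projection per step, replaces it. A Stinespring dilation would live on a new
  Hilbert space. Elimination on a kernel stays on the given one and directly produces a family
  indexed by natural numbers; this is where separability enters. Unitaries serve as generators
  because they are cheap sources of instruments: conjugation by \<open>u\<close> is one, and so is
  the pair of conjugations by (1 \<plusminus> w) / 2. That the two algebras commute gives the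
  inclusion of each in the commutant of the other; each of the two properties supplies a reverse
  inclusion.\<close>

lemma op_apply_simps [simp]:
  "(a + b) \<cdot> x = a \<cdot> x + b \<cdot> x" "(a - b) \<cdot> x = a \<cdot> x - b \<cdot> x" "(- a) \<cdot> x = - (a \<cdot> x)"
  "(a * b) \<cdot> x = a \<cdot> b \<cdot> x" "(c *\<^sub>C a) \<cdot> x = c *\<^sub>C (a \<cdot> x)" "1 \<cdot> x = x" "0 \<cdot> x = 0"
  by (transfer; simp)+

lemma op_apply_sum: "(\<Sum>i\<in>I. f i) \<cdot> x = (\<Sum>i\<in>I. f i \<cdot> x)"
  by (induction I rule: infinite_finite_induct) auto

lemma op_apply_zero_right [simp]: "a \<cdot> 0 = 0"
  and op_apply_diff_right: "a \<cdot> (x - y) = a \<cdot> x - a \<cdot> y"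
  using op_apply_bounded_linear[of a] by (simp_all add: linear_simps)

lemma op_bounded: obtains K where "0 < K" "\<And>x. norm (a \<cdot> x) \<le> K * norm x"
  using bounded_linear.pos_bounded[OF op_apply_bounded_linear[of a]] by (metis mult.commute)

lemma tendsto_op_apply: "(f \<longlongrightarrow> l) F \<Longrightarrow> ((\<lambda>i. a \<cdot> f i) \<longlongrightarrow> a \<cdot> l) F"
  by (rule bounded_linear.tendsto[OF op_apply_bounded_linear])

lemma cinner_zero_left [simp]: "cinner 0 x = 0"
  and cinner_zero_right [simp]: "cinner x 0 = 0"
  and cinner_minus_left: "cinner (- x) y = - cinner x y"
  and cinner_minus_right: "cinner x (- y) = - cinner x y"
  and cinner_diff_left: "cinner (x - y) z = cinner x z - cinner y z"
  and cinner_diff_right: "cinner x (y - z) = cinner x y - cinner x z"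
  for x y z :: "'h::complex_hilbert"
proof -
  show l0: "cinner 0 x = 0" for x :: 'h
    using cinner_add_left[of 0 0 x] by simp
  show r0: "cinner x 0 = 0" for x :: 'h
    using cinner_add_right[of x 0 0] by simp
  show lm: "cinner (- x) y = - cinner x y" for x y :: 'h
    using cinner_add_left[of x "- x" y] by (simp add: l0 eq_neg_iff_add_eq_0 add.commute)
  show rm: "cinner x (- y) = - cinner x y" for x y :: 'h
    using cinner_add_right[of x y "- y"] by (simp add: r0 eq_neg_iff_add_eq_0 add.commute)
  show "cinner (x - y) z = cinner x z - cinner y z"
    using cinner_add_left[of x "- y" z] by (simp add: lm)
  show "cinner x (y - z) = cinner x y - cinner x z"
    using cinner_add_right[of x y "- z"] by (simp add: rm)
qed

lemmas cinner_simps = cinner_add_left cinner_add_right cinner_diff_left cinner_diff_right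
  cinner_minus_left cinner_minus_right cinner_scaleC_left cinner_scaleC_right

lemma cinner_sum_right: "cinner x (\<Sum>i\<in>I. f i) = (\<Sum>i\<in>I. cinner x (f i))"
  for x :: "'h::complex_hilbert"
  by (induction I rule: infinite_finite_induct) (auto simp: cinner_add_right)

lemma cinner_self_eq_0 [simp]: "cinner x x = 0 \<longleftrightarrow> x = 0"
  for x :: "'h::complex_hilbert"
  by (simp add: cinner_self)

lemma cinner_eqI: "(\<And>y. cinner y u = cinner y v) \<Longrightarrow> u = v"
  for u v :: "'h::complex_hilbert"
  by (metis inner_eq_Re_cinner vector_eq_ldot)

lemma bdd_op_cinner_eqI: "(\<And>x y. cinner x (a \<cdot> y) = cinner x (b \<cdot> y)) \<Longrightarrow> a = b"
  by (intro bdd_op_eqI cinner_eqI)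

lemma scaleC_zero_left [simp]: "0 *\<^sub>C x = 0"
  using scaleC_add_left[of 0 0 x] by simp

lemma scaleC_minus_left: "(- c) *\<^sub>C x = - (c *\<^sub>C x)"
  using scaleC_add_left[of c "- c" x] by (simp add: eq_neg_iff_add_eq_0 add.commute)

text \<open>Rotating \<open>y\<close> by the phase \<open>c\<close> makes the inner product real and
  nonnegative, so the real Cauchy-Schwarz inequality applies.\<close>

lemma norm_cinner_le: "cmod (cinner x y) \<le> norm x * norm y"
  for x y :: "'h::complex_hilbert"
proof (cases "cinner x y = 0")
  case False
  define c where "c = cnj (cinner x y) / cmod (cinner x y)"
  have "complex_of_real (cmod (cinner x y)) = cinner x (c *\<^sub>C y)"
    using False by (simp add: c_def cinner_simps mult.commute[of "cnj _"] power2_eq_square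
        flip: complex_norm_square)
  then have "cmod (cinner x y) = inner x (c *\<^sub>C y)"
    by (simp add: inner_eq_Re_cinner) (metis Re_complex_of_real)
  also have "\<dots> \<le> norm x * norm (c *\<^sub>C y)"
    by (rule norm_cauchy_schwarz)
  also have "norm (c *\<^sub>C y) = norm y"
    using False by (simp add: norm_scaleC c_def norm_divide)
  finally show ?thesis .
qed simp

lemma bounded_bilinear_cinner: "bounded_bilinear (cinner :: 'h::complex_hilbert \<Rightarrow> _)"
proof
  show "\<exists>K. \<forall>a b::'h. cmod (cinner a b) \<le> norm a * norm b * K"
    using norm_cinner_le by (metis mult.right_neutral)
qed (simp_all add: cinner_simps scaleR_scaleC scaleR_conv_of_real)

lemmas tendsto_cinner = bounded_bilinear.tendsto[OF bounded_bilinear_cinner]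

lemma cinner_adj_right: "cinner x (adj a \<cdot> y) = cinner (a \<cdot> x) y"
  by (metis adj_cinner cinner_commute)

lemma adj_eqI: "(\<And>x y. cinner (b \<cdot> x) y = cinner x (a \<cdot> y)) \<Longrightarrow> adj a = b"
  by (rule bdd_op_cinner_eqI) (metis adj_cinner cinner_commute)

lemma adj_adj [simp]: "adj (adj a) = a"
  and adj_mult: "adj (a * b) = adj b * adj a"
  and adj_add: "adj (a + b) = adj a + adj b"
  and adj_diff: "adj (a - b) = adj a - adj b"
  and adj_scaleC: "adj (c *\<^sub>C a) = cnj c *\<^sub>C adj a"
  and adj_one [simp]: "adj 1 = 1"
  and adj_zero [simp]: "adj 0 = 0"
  by (rule adj_eqI; simp add: adj_cinner cinner_adj_right cinner_simps)+

lemma adj_minus: "adj (- a) = - adj a"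
  by (rule adj_eqI; simp add: adj_cinner cinner_adj_right cinner_simps)

lemma mult_scaleC [simp]: "a * c *\<^sub>C b = c *\<^sub>C (a * b)" "(c *\<^sub>C a) * b = c *\<^sub>C (a * b)"
  for a b :: "'h::complex_hilbert bdd_op"
  by (rule bdd_op_eqI; simp add: op_apply_scaleC)+

lemma adj_eq_self_iff: "adj a = a \<longleftrightarrow> (\<forall>x y. cinner (a \<cdot> x) y = cinner x (a \<cdot> y))"
  by (metis adj_cinner adj_eqI)

lemma cinner_self_adjoint_real: "adj a = a \<Longrightarrow> cinner x (a \<cdot> x) = of_real (Re (cinner x (a \<cdot> x)))"
  by (metis Im_complex_of_real adj_cinner cinner_commute complex_cnj_cancel_iff complex_is_Real_iff of_real_Re Reals_cnj_iff)

lemma bdd_op_exists: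
  assumes "\<And>x y. f (x + y) = f x + f y" "\<And>c x. f (c *\<^sub>C x) = c *\<^sub>C f x"
    and "\<And>x. norm (f x) \<le> K * norm x"
  obtains a :: "'h::complex_hilbert bdd_op" where "\<And>x. a \<cdot> x = f x"
proof
  have "bounded_linear f"
    by (rule bounded_linear_intro[where K = K]) (simp_all add: assms scaleR_scaleC mult.commute)
  then show "Bdd_op f \<cdot> x = f x" for x
    using assms by (simp add: Bdd_op_inverse)
qed

text \<open>Real Riesz representation is applied to the real part of \<open>B\<close> in its first
  argument; the imaginary part follows on replacing \<open>x\<close> by
  \<open>\<i> *\<^sub>C x\<close>. This turns the rows of the Cholesky factor into Kraus
  operators.\<close>

lemma sesquilinear_form_op:
  fixes B :: "'h::complex_hilbert \<Rightarrow> 'h \<Rightarrow> complex"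
  assumes "\<And>x y z. B (x + y) z = B x z + B y z" "\<And>c x z. B (c *\<^sub>C x) z = cnj c * B x z"
    and "\<And>x y z. B x (y + z) = B x y + B x z" "\<And>c x z. B x (c *\<^sub>C z) = c * B x z"
    and bound: "\<And>x y. cmod (B x y) \<le> K * norm x * norm y"
  obtains k where "\<And>x y. cinner x (k \<cdot> y) = B x y"
proof -
  have "bounded_linear (\<lambda>x. Re (B x y))" for y
  proof (rule bounded_linear_intro[where K = "K * norm y"])
    show "norm (Re (B x y)) \<le> norm x * (K * norm y)" for x
      using bound[of x y] abs_Re_le_cmod[of "B x y"] by (simp add: mult_ac)
  qed (simp_all add: assms scaleR_scaleC)
  then have "\<exists>z. \<forall>x. Re (B x y) = inner z x" for y
    by (rule riesz_real)
  then obtain f where f: "\<And>x y. Re (B x y) = inner (f y) x"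
    by metis
  have c: "cinner x (f y) = B x y" for x y
  proof -
    have "Im (B x y) = Re (B (\<i> *\<^sub>C x) y)" "Im (cinner x (f y)) = Re (cinner (\<i> *\<^sub>C x) (f y))"
      by (simp_all add: assms cinner_simps)
    then show ?thesis
      by (simp add: complex_eq_iff f inner_eq_Re_cinner[symmetric] inner_commute)
  qed
  have "norm (f y) \<le> (K * norm y)" for y
  proof (cases "f y = 0")
    case False
    have "norm (f y) * norm (f y) = cmod (B (f y) y)"
      by (simp add: cinner_self power2_eq_square norm_mult flip: c)
    then have "norm (f y) * norm (f y) \<le> norm (f y) * (K * norm y)"
      using bound[of "f y" y] by (simp add: mult_ac)
    with False show ?thesis
      by (simp add: mult_le_cancel_left)
  next
    case True
    \<comment> \<open>The claim is now \<open>0 \<le> K * norm y\<close>; the sign is read off from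
      the bound at the pair \<open>y\<close>, \<open>y\<close>.\<close>
    show ?thesis
    proof (cases "y = 0")
      case False
      have "0 \<le> K * norm y * norm y"
        using bound[of y y] by (meson norm_ge_zero order_trans)
      then show ?thesis
        using False True by (simp add: zero_le_mult_iff)
    qed (use True in simp)
  qed
  moreover have "f (x + y) = f x + f y" for x y
    by (rule cinner_eqI) (simp add: c cinner_simps assms)
  moreover have "f (r *\<^sub>C x) = r *\<^sub>C f x" for r x
    by (rule cinner_eqI) (simp add: c cinner_simps assms)
  ultimately obtain k where "\<And>x. k \<cdot> x = f x"
    using bdd_op_exists[of f K] by metis
  then show thesis
    using c that by metis
qed

text \<open>The rank one operator |x\<rangle>\<langle>y|, linear in \<open>x\<close> and conjugate
  linear in \<open>y\<close>.\<close>

lift_definition ket :: "'h::complex_hilbert \<Rightarrow> 'h \<Rightarrow> 'h bdd_op" is "\<lambda>x y z. cinner y z *\<^sub>C x"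
proof (intro conjI allI)
  show "bounded_linear (\<lambda>z. cinner y z *\<^sub>C x)" for x y :: 'h
  proof (rule bounded_linear_intro[where K = "norm y * norm x"])
    show "norm (cinner y z *\<^sub>C x) \<le> norm z * (norm y * norm x)" for z
      using mult_right_mono[OF norm_cinner_le[of y z], of "norm x"]
      by (simp add: norm_scaleC mult_ac)
  qed (simp_all add: cinner_simps scaleC_add_left scaleR_scaleC scaleC_scaleC)
qed (simp add: cinner_simps scaleC_scaleC)

lemma ket_apply [simp]: "ket x y \<cdot> z = cinner y z *\<^sub>C x"
  by transfer simp

text \<open>Polarization expresses \<open>4 * Re (cinner y (a \<cdot> x))\<close> by the quadratic
  form at \<open>x + y\<close> and \<open>x - y\<close>. With \<open>y\<close> the multiple of
  \<open>a \<cdot> x\<close> that has the norm of \<open>x\<close>, the parallelogram law gives the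
  bound.\<close>

lemma norm_le_of_numerical_range:
  assumes "adj a = a" and q: "\<And>x. \<bar>Re (cinner x (a \<cdot> x))\<bar> \<le> r * (norm x)\<^sup>2"
  shows "norm (a \<cdot> x) \<le> r * norm x"
proof (cases "a \<cdot> x = 0 \<or> x = 0")
  case True
  show ?thesis
  proof (cases "x = 0")
    case False
    have "0 \<le> r * (norm x)\<^sup>2"
      using q[of x] by (meson abs_ge_zero order_trans)
    then show ?thesis
      using False True by (simp add: zero_le_mult_iff)
  qed simp
next
  case False
  have sym: "Re (cinner x (a \<cdot> y)) = Re (cinner y (a \<cdot> x))" for x y
    by (metis adj_cinner assms(1) inner_commute inner_eq_Re_cinner)
  define y where "y = (norm x / norm (a \<cdot> x)) *\<^sub>R (a \<cdot> x)"
  have ny: "norm y = norm x"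
    using False by (simp add: y_def)
  have "4 * Re (cinner y (a \<cdot> x)) =
      Re (cinner (x + y) (a \<cdot> (x + y))) - Re (cinner (x - y) (a \<cdot> (x - y)))"
    by (simp add: op_apply_add op_apply_diff_right cinner_simps sym[of x y])
  also have "\<dots> \<le> r * (norm (x + y))\<^sup>2 + r * (norm (x - y))\<^sup>2"
    using q[of "x + y"] q[of "x - y"] by linarith
  also have "\<dots> = r * (2 * (norm x)\<^sup>2 + 2 * (norm y)\<^sup>2)"
    by (simp add: power2_norm_eq_inner inner_simps algebra_simps)
  finally have "Re (cinner y (a \<cdot> x)) \<le> r * (norm x)\<^sup>2"
    by (simp add: ny)
  moreover have "Re (cinner y (a \<cdot> x)) = norm x * norm (a \<cdot> x)"
    using False by (simp add: y_def power2_norm_eq_inner[symmetric] power2_eq_square flip: inner_eq_Re_cinner)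
  ultimately show ?thesis
    using False by (simp add: power2_eq_square mult_ac mult_le_cancel_left)
qed

subsection \<open>Square roots and unitaries\<close>

lemma scaleC_two: "2 *\<^sub>C x = x + x"
  using scaleC_add_left[of 1 1 x] by (simp add: scaleC_one)

lemma ex_op_limit:
  assumes "\<And>x. convergent (\<lambda>n. a n \<cdot> x)" and "\<And>n x. norm (a n \<cdot> x) \<le> K * norm x"
  obtains b :: "'h::complex_hilbert bdd_op" where "\<And>x. (\<lambda>n. a n \<cdot> x) \<longlonglongrightarrow> b \<cdot> x"
proof -
  have L: "(\<lambda>n. a n \<cdot> x) \<longlonglongrightarrow> lim (\<lambda>n. a n \<cdot> x)" for x
    using assms(1) by (simp add: convergent_LIMSEQ_iff)
  obtain b where b: "\<And>x. b \<cdot> x = lim (\<lambda>n. a n \<cdot> x)"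
  proof (rule bdd_op_exists)
    show "lim (\<lambda>n. a n \<cdot> (x + y)) = lim (\<lambda>n. a n \<cdot> x) + lim (\<lambda>n. a n \<cdot> y)" for x y
      by (rule limI) (auto simp: op_apply_add intro!: tendsto_add L)
    \<comment> \<open>Continuity of multiplication by \<open>c\<close> is that of the bounded
      operator \<open>c *\<^sub>C 1\<close>.\<close>
    show "lim (\<lambda>n. a n \<cdot> (c *\<^sub>C x)) = c *\<^sub>C lim (\<lambda>n. a n \<cdot> x)" for c x
      using tendsto_op_apply[OF L, of "c *\<^sub>C 1" x] by (intro limI) (simp add: op_apply_scaleC)
    show "norm (lim (\<lambda>n. a n \<cdot> x)) \<le> K * norm x" for x
      by (rule Lim_norm_ubound[OF _ L]) (use assms(2) in auto)
  qed blast
  show thesis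
    by (rule that[of b]) (simp add: b L)
qed

text \<open>
  The iteration \<open>b\<^sub>0 = 0\<close>, \<open>b\<^sub>n\<^sub>+\<^sub>1 = (x + b\<^sub>n\<^sup>2) / 2\<close> is dominated in norm, together with its increments, by
  the scalar iteration with \<open>x = 1\<close>, which is increasing and bounded by \<open>1\<close>.
\<close>

lemma sqrt_one_minus:
  fixes x :: "'h::complex_hilbert bdd_op"
  assumes sa: "adj x = x" and contr: "\<And>y. norm (x \<cdot> y) \<le> norm y"
  obtains b where "adj b = b" "\<And>y. norm (b \<cdot> y) \<le> norm y" "(1 - b) * (1 - b) = 1 - x"
    "\<And>c. c * x = x * c \<Longrightarrow> c * b = b * c"
proof -
  define b where "b = rec_nat 0 (\<lambda>_ b. (1/2) *\<^sub>C (x + b * b))"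
  define \<beta> where "\<beta> = rec_nat 0 (\<lambda>_ t. (1/2) * (1 + t * t :: real))"
  have b_simps: "b 0 = 0" "\<And>n. b (Suc n) = (1/2) *\<^sub>C (x + b n * b n)"
    by (simp_all add: b_def)
  have \<beta>_simps: "\<beta> 0 = 0" "\<And>n. \<beta> (Suc n) = (1/2) * (1 + \<beta> n * \<beta> n)"
    by (simp_all add: \<beta>_def)
  have \<beta>: "0 \<le> \<beta> n \<and> \<beta> n \<le> 1" for n
  proof (induction n)
    case (Suc n)
    then have "\<beta> n * \<beta> n \<le> 1 * 1" by (intro mult_mono) auto
    then show ?case using Suc by (simp add: \<beta>_simps)
  qed (simp add: \<beta>_simps)
  \<comment> \<open>The increment is half the square of \<open>\<beta> n - 1\<close>.\<close>
  have inc: "\<beta> n \<le> \<beta> (Suc n)" for n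
    using sum_squares_ge_zero[of "\<beta> n - 1" 0] by (simp add: \<beta>_simps algebra_simps)
  have half: "norm ((1/2::complex) *\<^sub>C z) = norm z / 2" for z :: 'h
    by (simp add: norm_scaleC norm_divide)
  have b_le: "norm (b n \<cdot> y) \<le> \<beta> n * norm y" for n y
  proof (induction n arbitrary: y)
    case (Suc n)
    have "norm (b n \<cdot> b n \<cdot> y) \<le> \<beta> n * (\<beta> n * norm y)"
      using \<beta> by (intro order_trans[OF Suc mult_left_mono[OF Suc]]) simp
    then show ?case
      using norm_triangle_ineq[of "x \<cdot> y" "b n \<cdot> b n \<cdot> y"] contr[of y]
      by (simp add: b_simps \<beta>_simps half algebra_simps)
  qed (simp add: b_simps \<beta>_simps)
  have step: "norm (b (Suc n) \<cdot> y - b n \<cdot> y) \<le> (\<beta> (Suc n) - \<beta> n) * norm y" for n y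
  proof (induction n arbitrary: y)
    case 0
    then show ?case using contr[of y] by (simp add: b_simps \<beta>_simps half)
  next
    case (Suc n)
    let ?d = "\<lambda>z. b (Suc n) \<cdot> z - b n \<cdot> z" and ?e = "\<beta> (Suc n) - \<beta> n"
    have e: "0 \<le> ?e" using inc[of n] by simp
    have b_Suc: "b (Suc m) \<cdot> y = (1/2) *\<^sub>C (x \<cdot> y + b m \<cdot> b m \<cdot> y)" for m
      by (simp add: b_simps)
    have "b (Suc (Suc n)) \<cdot> y - b (Suc n) \<cdot> y =
        (1/2) *\<^sub>C (x \<cdot> y + b (Suc n) \<cdot> b (Suc n) \<cdot> y) - (1/2) *\<^sub>C (x \<cdot> y + b n \<cdot> b n \<cdot> y)"
      by (rule arg_cong2[where f = "(-)", OF b_Suc[of "Suc n"] b_Suc[of n]])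
    \<comment> \<open>A difference of squares splits as b (b - b') + (b - b') b' without any
      commutation; the induction hypothesis and \<open>b_le\<close> bound the two terms, and for
      \<open>\<beta>\<close> the same split is an equality.\<close>
    also have "\<dots> = (1/2) *\<^sub>C (b (Suc n) \<cdot> ?d y + ?d (b n \<cdot> y))"
      by (simp add: op_apply_diff_right flip: scaleC_diff_right)
    finally have "b (Suc (Suc n)) \<cdot> y - b (Suc n) \<cdot> y = (1/2) *\<^sub>C (b (Suc n) \<cdot> ?d y + ?d (b n \<cdot> y))" .
    moreover have "norm (b (Suc n) \<cdot> ?d y) \<le> \<beta> (Suc n) * (?e * norm y)"
      using \<beta> by (intro order_trans[OF b_le mult_left_mono[OF Suc]]) simp
    moreover have "norm (?d (b n \<cdot> y)) \<le> ?e * (\<beta> n * norm y)"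
      using e by (intro order_trans[OF Suc mult_left_mono[OF b_le]])
    moreover have "\<beta> (Suc n) * (?e * norm y) + ?e * (\<beta> n * norm y) =
        2 * ((\<beta> (Suc (Suc n)) - \<beta> (Suc n)) * norm y)"
    proof -
      have e2: "\<beta> (Suc (Suc n)) - \<beta> (Suc n) =
          (1/2) * (1 + \<beta> (Suc n) * \<beta> (Suc n)) - (1/2) * (1 + \<beta> n * \<beta> n)"
        by (rule arg_cong2[where f = "(-)", OF \<beta>_simps(2)[of "Suc n"] \<beta>_simps(2)[of n]])
      show ?thesis unfolding e2 by (simp add: algebra_simps)
    qed
    ultimately show ?case
      using norm_triangle_ineq[of "b (Suc n) \<cdot> ?d y" "?d (b n \<cdot> y)"] by (simp only: half)
  qed
  have steps: "norm (b (n + k) \<cdot> y - b n \<cdot> y) \<le> (\<beta> (n + k) - \<beta> n) * norm y" for n k y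
  proof (induction k)
    case (Suc k)
    have "b (n + Suc k) \<cdot> y - b n \<cdot> y = (b (Suc (n + k)) \<cdot> y - b (n + k) \<cdot> y) + (b (n + k) \<cdot> y - b n \<cdot> y)"
      by simp
    then show ?case
      using norm_triangle_ineq[of "b (Suc (n + k)) \<cdot> y - b (n + k) \<cdot> y" "b (n + k) \<cdot> y - b n \<cdot> y"]
        step[of "n + k" y] Suc by (simp add: algebra_simps)
  qed simp
  have "convergent \<beta>"
    using inc \<beta> by (intro Bseq_monoseq_convergent BseqI'[of _ 1]) (auto simp: monoseq_Suc)
  then have C: "Cauchy \<beta>"
    by (simp add: Cauchy_convergent_iff)
  have "convergent (\<lambda>n. b n \<cdot> y)" for y
  proof (unfold Cauchy_convergent_iff[symmetric], rule metric_CauchyI)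
    fix e :: real assume "0 < e"
    then have "0 < e / (norm y + 1)"
      by (simp add: add_nonneg_pos)
    then obtain M where M: "\<And>m n. m \<ge> M \<Longrightarrow> n \<ge> M \<Longrightarrow> dist (\<beta> m) (\<beta> n) < e / (norm y + 1)"
      using metric_CauchyD[OF C] by blast
    have *: "dist (b (n + k) \<cdot> y) (b n \<cdot> y) < e" if "n \<ge> M" for n k
    proof -
      have "\<beta> (n + k) - \<beta> n < e / (norm y + 1)"
        using M[of "n + k" n] that by (auto simp: dist_real_def)
      then have "(\<beta> (n + k) - \<beta> n) * (norm y + 1) < e"
        by (simp add: pos_less_divide_eq add_nonneg_pos)
      moreover have "0 \<le> \<beta> (n + k) - \<beta> n"
        using lift_Suc_mono_le[of \<beta>, OF inc] by simp
      ultimately show ?thesis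
        using steps[of n k y] by (simp add: dist_norm algebra_simps)
    qed
    have "dist (b m \<cdot> y) (b n \<cdot> y) < e" if "m \<ge> M" "n \<ge> M" for m n
      using *[of n "m - n"] *[of m "n - m"] that by (cases "n \<le> m") (auto simp: dist_commute)
    then show "\<exists>M. \<forall>m\<ge>M. \<forall>n\<ge>M. dist (b m \<cdot> y) (b n \<cdot> y) < e" by blast
  qed
  moreover have b_contr: "norm (b n \<cdot> y) \<le> 1 * norm y" for n y
    using \<beta> by (intro order_trans[OF b_le mult_right_mono]) auto
  ultimately obtain c where c: "\<And>y. (\<lambda>n. b n \<cdot> y) \<longlonglongrightarrow> c \<cdot> y"
    using ex_op_limit by blast
  show thesis
  proof
    have b_sa: "adj (b n) = b n" for n
      by (induction n) (simp_all add: b_simps adj_scaleC adj_add adj_mult sa)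
    show "adj c = c"
      unfolding adj_eq_self_iff
    proof (intro allI)
      fix y z
      have "(\<lambda>n. cinner (b n \<cdot> y) z) \<longlonglongrightarrow> cinner (c \<cdot> y) z"
        by (intro tendsto_cinner c tendsto_const)
      moreover have "(\<lambda>n. cinner (b n \<cdot> y) z) = (\<lambda>n. cinner y (b n \<cdot> z))"
        by (rule ext) (subst b_sa[symmetric], rule adj_cinner)
      moreover have "(\<lambda>n. cinner y (b n \<cdot> z)) \<longlonglongrightarrow> cinner y (c \<cdot> z)"
        by (intro tendsto_cinner c tendsto_const)
      ultimately show "cinner (c \<cdot> y) z = cinner y (c \<cdot> z)"
        using LIMSEQ_unique by auto
    qed
    show "norm (c \<cdot> y) \<le> norm y" for y
      by (rule Lim_norm_ubound[OF _ c]) (use b_contr in auto)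
    show "d * c = c * d" if "d * x = x * d" for d
    proof (rule bdd_op_eqI)
      fix y
      have com: "d * b n = b n * d" for n
      proof (induction n)
        case (Suc n)
        then have "d * (b n * b n) = b n * b n * d"
          by (metis mult.assoc)
        then show ?case by (simp add: b_simps distrib_left distrib_right that)
      qed (simp add: b_simps)
      have "(\<lambda>n. d \<cdot> b n \<cdot> y) \<longlonglongrightarrow> d \<cdot> c \<cdot> y"
        by (intro tendsto_op_apply c)
      moreover have "d \<cdot> b n \<cdot> y = b n \<cdot> d \<cdot> y" for n
        by (simp add: com flip: op_apply_simps(4))
      ultimately show "(d * c) \<cdot> y = (c * d) \<cdot> y"
        using LIMSEQ_unique[OF c[of "d \<cdot> y"]] by simp
    qed
    \<comment> \<open>The limit of the recursion, which rearranges to the claim. For the product,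
      the uniformly bounded \<open>b n\<close> acts on the error
      \<open>b n \<cdot> y - c \<cdot> y\<close>.\<close>
    have "2 *\<^sub>C (c \<cdot> y) = x \<cdot> y + c \<cdot> c \<cdot> y" for y
    proof -
      have "(\<lambda>n. b n \<cdot> b n \<cdot> y) \<longlonglongrightarrow> c \<cdot> c \<cdot> y"
      proof -
        have "(\<lambda>n. b n \<cdot> (b n \<cdot> y - c \<cdot> y)) \<longlonglongrightarrow> 0"
        proof (rule Lim_null_comparison)
          show "\<forall>\<^sub>F n in sequentially. norm (b n \<cdot> (b n \<cdot> y - c \<cdot> y)) \<le> norm (b n \<cdot> y - c \<cdot> y)"
            using b_contr by auto
          show "(\<lambda>n. norm (b n \<cdot> y - c \<cdot> y)) \<longlonglongrightarrow> 0"
            using c[of y] by (simp add: tendsto_norm_zero_iff LIM_zero_iff)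
        qed
        from tendsto_add[OF this c[of "c \<cdot> y"]] show ?thesis
          by (simp add: op_apply_diff_right)
      qed
      then have "(\<lambda>n. 2 *\<^sub>C (b (Suc n) \<cdot> y)) \<longlonglongrightarrow> x \<cdot> y + c \<cdot> c \<cdot> y"
        by (simp add: b_simps scaleC_scaleC scaleC_one tendsto_add)
      moreover have "(\<lambda>n. 2 *\<^sub>C (b (Suc n) \<cdot> y)) \<longlonglongrightarrow> 2 *\<^sub>C (c \<cdot> y)"
        using tendsto_op_apply[OF LIMSEQ_Suc[OF c[of y]], of "2 *\<^sub>C 1"] by simp
      ultimately show ?thesis
        using LIMSEQ_unique by blast
    qed
    then have "c + c = x + c * c"
      by (intro bdd_op_eqI) (simp add: scaleC_two)
    then show "(1 - c) * (1 - c) = 1 - x"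
      by (simp add: algebra_simps)
  qed
qed

lemma norm_square_self_adjoint: "adj a = a \<Longrightarrow> Re (cinner x (a \<cdot> a \<cdot> x)) = (norm (a \<cdot> x))\<^sup>2"
  using adj_cinner[of a x "a \<cdot> x"]
  by (simp add: inner_eq_Re_cinner power2_norm_eq_inner)

text \<open>Expanding the square gives at most
  \<open>(norm y)\<^sup>2 - (norm (c \<cdot> y))\<^sup>2\<close>. It makes
  \<open>sqrt_one_minus\<close> applicable to \<open>1 - c * c\<close>, whose output is then the
  absolute value of \<open>c\<close>.\<close>

lemma contraction_one_minus_square:
  assumes "adj c = c" "\<And>y. norm (c \<cdot> y) \<le> norm y"
  shows "norm ((1 - c * c) \<cdot> y) \<le> norm y"
proof -
  have "(norm (y - c \<cdot> c \<cdot> y))\<^sup>2 = (norm y)\<^sup>2 - 2 * inner y (c \<cdot> c \<cdot> y) + (norm (c \<cdot> c \<cdot> y))\<^sup>2"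
    by (simp add: power2_norm_eq_inner inner_simps inner_commute)
  also have "inner y (c \<cdot> c \<cdot> y) = (norm (c \<cdot> y))\<^sup>2"
    using norm_square_self_adjoint[OF assms(1)] by (simp add: inner_eq_Re_cinner)
  also have "(norm (c \<cdot> c \<cdot> y))\<^sup>2 \<le> (norm (c \<cdot> y))\<^sup>2"
    by (simp add: assms(2) power_mono)
  finally have "(norm (y - c \<cdot> c \<cdot> y))\<^sup>2 \<le> (norm y)\<^sup>2"
    using zero_le_power2[of "norm (c \<cdot> y)"] by linarith
  then show ?thesis
    by (auto intro: power2_le_imp_le)
qed

section \<open>Commutants of adjoint-closed sets and their unitaries\<close>

lemma commutant_one: "1 \<in> commutant S"
  and commutant_scaleC: "a \<in> commutant S \<Longrightarrow> c *\<^sub>C a \<in> commutant S"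
  and commutant_add: "a \<in> commutant S \<Longrightarrow> b \<in> commutant S \<Longrightarrow> a + b \<in> commutant S"
  and commutant_diff: "a \<in> commutant S \<Longrightarrow> b \<in> commutant S \<Longrightarrow> a - b \<in> commutant S"
  by (auto simp: commutant_def distrib_left distrib_right left_diff_distrib right_diff_distrib)

lemma commutant_mult:
  assumes "a \<in> commutant S" "b \<in> commutant S"
  shows "a * b \<in> commutant S"
proof -
  have "x * (a * b) = a * b * x" if "x \<in> S" for x
    using assms that unfolding commutant_def by (metis (mono_tags, lifting) mem_Collect_eq mult.assoc)
  then show ?thesis by (simp add: commutant_def)
qed

lemmas commutant_ops = commutant_one commutant_scaleC commutant_add commutant_diff commutant_mult

lemma commutant_adj:
  assumes "\<And>a. a \<in> S \<Longrightarrow> adj a \<in> S" "b \<in> commutant S"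
  shows "adj b \<in> commutant S"
proof -
  have "a * adj b = adj b * a" if "a \<in> S" for a
    using assms that unfolding commutant_def by (metis (mono_tags, lifting) adj_adj adj_mult mem_Collect_eq)
  then show ?thesis by (simp add: commutant_def)
qed

definition unitary :: "'h::complex_hilbert bdd_op \<Rightarrow> bool" where
  "unitary u \<longleftrightarrow> adj u * u = 1 \<and> u * adj u = 1"

lemma self_adjoint_decomposition:
  fixes a :: "'h::complex_hilbert bdd_op"
  assumes "\<And>x. x \<in> S \<Longrightarrow> adj x \<in> S" "a \<in> commutant S"
  obtains b c where "b \<in> commutant S" "c \<in> commutant S" "adj b = b" "adj c = c" "a = b + \<i> *\<^sub>C c"
proof
  have "adj a \<in> commutant S"
    by (rule commutant_adj) (fact assms)+
  then show "(1/2) *\<^sub>C (a + adj a) \<in> commutant S" "(-\<i>/2) *\<^sub>C (a - adj a) \<in> commutant S"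
    using assms(2) by (auto intro: commutant_ops)
  show "adj ((1/2) *\<^sub>C (a + adj a)) = (1/2) *\<^sub>C (a + adj a)"
    by (simp add: adj_scaleC adj_add add.commute)
  have "adj ((-\<i>/2) *\<^sub>C (a - adj a)) = (\<i>/2) *\<^sub>C (adj a - a)"
    by (simp add: adj_scaleC adj_diff)
  then show "adj ((-\<i>/2) *\<^sub>C (a - adj a)) = (-\<i>/2) *\<^sub>C (a - adj a)"
    using scaleC_minus_left[of "\<i>/2" "a - adj a"] scaleC_minus_right[of "\<i>/2" "a - adj a"] by simp
  have "(1/2::complex) *\<^sub>C (a + adj a) + \<i> *\<^sub>C (-\<i>/2) *\<^sub>C (a - adj a) = (1/2) *\<^sub>C ((a + adj a) + (a - adj a))"
    by (simp only: scaleC_scaleC scaleC_add_right) simp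
  also have "\<dots> = (1/2) *\<^sub>C (a + a)"
    by simp
  also have "\<dots> = a"
    by (simp only: scaleC_add_right flip: scaleC_add_left) (simp add: scaleC_one)
  finally show "a = (1/2) *\<^sub>C (a + adj a) + \<i> *\<^sub>C (-\<i>/2) *\<^sub>C (a - adj a)" ..
qed

text \<open>A self-adjoint contraction \<open>s\<close> is the real part of the unitary \<open>s + \<i> \<surd>(1 - s\<^sup>2)\<close>.\<close>

lemma commutant_unitary_induct:
  fixes a :: "'h::complex_hilbert bdd_op"
  assumes S: "\<And>x. x \<in> S \<Longrightarrow> adj x \<in> S" and a: "a \<in> commutant S"
    and u: "\<And>u. u \<in> commutant S \<Longrightarrow> unitary u \<Longrightarrow> P u"
    and add: "\<And>a b. P a \<Longrightarrow> P b \<Longrightarrow> P (a + b)" and scale: "\<And>c a. P a \<Longrightarrow> P (c *\<^sub>C a)"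
  shows "P a"
proof -
  have contr: "P s" if s: "s \<in> commutant S" "adj s = s" "\<And>y. norm (s \<cdot> y) \<le> norm y" for s
  proof -
    have "adj (s * s) = s * s" "\<And>y. norm ((s * s) \<cdot> y) \<le> norm y"
      using s(2) order_trans[OF s(3) s(3)] by (simp_all add: adj_mult)
    then obtain b where b: "adj b = b" "(1 - b) * (1 - b) = 1 - s * s"
      "\<And>c. c * (s * s) = (s * s) * c \<Longrightarrow> c * b = b * c"
      using sqrt_one_minus by metis
    \<comment> \<open>The square root of \<open>1 - s * s\<close>; \<open>sqrt_one_minus\<close>
      delivers roots in the form \<open>1 - b\<close>.\<close>
    define w where "w = 1 - b"
    have ss: "s * s \<in> commutant S"
      using s(1) by (intro commutant_ops)
    have "c * b = b * c" if "c \<in> S" for c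
      using b(3) ss that by (simp add: commutant_def)
    then have "b \<in> commutant S"
      by (simp add: commutant_def)
    then have w: "w \<in> commutant S" "adj w = w" "w * w = 1 - s * s"
      by (simp_all add: w_def adj_diff b commutant_ops)
    \<comment> \<open>\<open>s\<close> commutes with its own square, hence with \<open>b\<close>;
      this cancels the cross terms in \<open>adj u * u\<close> and \<open>u * adj u\<close>.\<close>
    have "s * b = b * s"
      by (rule b(3)) (simp add: mult.assoc)
    then have sw: "s * w = w * s"
      by (simp add: w_def algebra_simps)
    define u where "u = s + \<i> *\<^sub>C w"
    have u_adj: "adj u = s - \<i> *\<^sub>C w"
      by (simp add: u_def adj_add adj_scaleC w s scaleC_minus_left)
    have "unitary u"
      by (simp add: unitary_def u_adj) (simp add: u_def algebra_simps sw w scaleC_scaleC scaleC_minus_left scaleC_one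
          scaleC_add_right scaleC_diff_right)
    then have "unitary (adj u)"
      by (simp add: unitary_def)
    have "u \<in> commutant S" "adj u \<in> commutant S"
      unfolding u_adj unfolding u_def using s w by (auto intro!: commutant_ops)
    then have "P ((1/2) *\<^sub>C (u + adj u))"
      using \<open>unitary u\<close> \<open>unitary (adj u)\<close> by (intro scale add u)
    also have "u + adj u = s + s"
      unfolding u_adj by (simp add: u_def)
    also have "(1/2) *\<^sub>C (s + s) = s"
      by (simp only: scaleC_add_right flip: scaleC_add_left) (simp add: scaleC_one)
    finally show ?thesis .
  qed
  have sa: "P s" if s: "s \<in> commutant S" "adj s = s" for s
  proof -
    obtain K where K: "0 < K" "\<And>y. norm (s \<cdot> y) \<le> K * norm y"
      using op_bounded by blast
    let ?s = "complex_of_real (1 / K) *\<^sub>C s"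
    have "norm (?s \<cdot> y) \<le> norm y" for y
      using K by (simp add: norm_scaleC norm_divide field_simps)
    then have "P ?s"
      using s by (intro contr commutant_ops) (auto simp: adj_scaleC)
    then have "P (complex_of_real K *\<^sub>C ?s)"
      by (rule scale)
    then show ?thesis
      using K by (simp add: scaleC_scaleC scaleC_one)
  qed
  obtain b c where "b \<in> commutant S" "c \<in> commutant S" "adj b = b" "adj c = c" "a = b + \<i> *\<^sub>C c"
    using self_adjoint_decomposition[OF S a] .
  then show ?thesis
    using sa add scale by metis
qed

subsection \<open>Projections\<close>

definition complex_subspace :: "'h::complex_hilbert set \<Rightarrow> bool" where
  "complex_subspace K \<longleftrightarrow> 0 \<in> K \<and> (\<forall>x\<in>K. \<forall>y\<in>K. x + y \<in> K) \<and> (\<forall>c. \<forall>x\<in>K. c *\<^sub>C x \<in> K)"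

lemma complex_subspace_diff: "complex_subspace K \<Longrightarrow> x \<in> K \<Longrightarrow> y \<in> K \<Longrightarrow> x - y \<in> K"
  unfolding complex_subspace_def
  by (metis diff_conv_add_uminus scaleC_minus_left scaleC_one)

text \<open>A minimizing sequence for the distance from \<open>x\<close> to \<open>K\<close> is
  Cauchy by the parallelogram law, since midpoints stay in \<open>K\<close>. Moving the minimizer
  along \<open>y\<close> gives real orthogonality, and moving it along
  \<open>\<i> *\<^sub>C y\<close> the imaginary part.\<close>

lemma orthogonal_decomposition:
  fixes x :: "'h::complex_hilbert"
  assumes sub: "complex_subspace K" and "closed K"
  shows "\<exists>z\<in>K. \<forall>y\<in>K. cinner y (x - z) = 0"
proof -
  have add: "y + y' \<in> K" and scale: "c *\<^sub>C y \<in> K" if "y \<in> K" "y' \<in> K" for y y' c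
    using sub that by (auto simp: complex_subspace_def)
  define J where "J y = (norm (x - y))\<^sup>2" for y
  define m where "m = Inf (J ` K)"
  have "0 \<in> K"
    using sub by (simp add: complex_subspace_def)
  have bdd: "bdd_below (J ` K)"
    by (rule bdd_belowI2[of _ 0]) (simp add: J_def)
  have m_le: "m \<le> J y" if "y \<in> K" for y
    unfolding m_def using that bdd by (simp add: cInf_lower)
  have "\<exists>y\<in>K. J y < m + inverse (real (Suc n))" for n
    using cInf_lessD[of "J ` K" "m + inverse (real (Suc n))"] \<open>0 \<in> K\<close> by (auto simp: m_def)
  then obtain X where X: "\<And>n. X n \<in> K" "\<And>n. J (X n) < m + inverse (real (Suc n))"
    by metis
  have gap: "(norm (y - z))\<^sup>2 \<le> 2 * (J y - m) + 2 * (J z - m)" if "y \<in> K" "z \<in> K" for y z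
  proof -
    have "(norm (y - z))\<^sup>2 = 2 * J y + 2 * J z - 4 * J ((1/2) *\<^sub>R (y + z))"
      by (simp add: J_def power2_norm_eq_inner inner_diff_left inner_diff_right
          inner_add_left inner_add_right inner_commute algebra_simps del: scaleR_add_right)
    moreover have "4 * m \<le> 4 * J ((1/2) *\<^sub>R (y + z))"
      using that by (intro mult_left_mono m_le) (simp_all only: scaleR_scaleC scale add)
    ultimately show ?thesis
      by (simp add: algebra_simps)
  qed
  have "Cauchy X"
  proof (rule metric_CauchyI)
    fix e :: real
    assume e: "0 < e"
    obtain N where N: "inverse (real (Suc N)) < e\<^sup>2 / 4"
      using reals_Archimedean[of "e\<^sup>2 / 4"] e by auto
    have X_N: "J (X i) < m + e\<^sup>2 / 4" if "N \<le> i" for i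
    proof -
      have "inverse (real (Suc i)) \<le> inverse (real (Suc N))"
        using that by (auto intro!: le_imp_inverse_le)
      with X(2)[of i] N show ?thesis
        by linarith
    qed
    have "dist (X i) (X j) < e" if "N \<le> i" "N \<le> j" for i j
    proof -
      have "2 * (J (X i) - m) + 2 * (J (X j) - m) < e\<^sup>2"
        using X_N[OF that(1)] X_N[OF that(2)] by simp
      with gap[OF X(1) X(1), of i j] have "(norm (X i - X j))\<^sup>2 < e\<^sup>2"
        by (rule le_less_trans)
      then show ?thesis
        using e by (simp add: dist_norm power_less_imp_less_base)
    qed
    then show "\<exists>M. \<forall>i\<ge>M. \<forall>j\<ge>M. dist (X i) (X j) < e" by blast
  qed
  then obtain z where z: "X \<longlonglongrightarrow> z"
    using Cauchy_convergent convergent_def by blast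
  have "z \<in> K"
    using \<open>closed K\<close> X(1) z by (rule closed_sequentially)
  have "(\<lambda>n. J (X n)) \<longlonglongrightarrow> J z"
    unfolding J_def by (intro tendsto_intros z)
  moreover have "(\<lambda>n. m + inverse (real (Suc n))) \<longlonglongrightarrow> m + 0"
    by (intro tendsto_intros LIMSEQ_inverse_real_of_nat)
  ultimately have "J z \<le> m + 0"
    by (rule LIMSEQ_le) (intro exI allI impI less_imp_le X)
  then have Jz: "J z \<le> J y" if "y \<in> K" for y
    using m_le[OF that] by simp
  have real_orth: "inner y (x - z) = 0" if "y \<in> K" for y
  proof (cases "y = 0")
    case False
    have expand: "(norm (v - t *\<^sub>R y))\<^sup>2 = (norm v)\<^sup>2 - 2 * t * inner y v + t\<^sup>2 * (norm y)\<^sup>2" for v t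
      unfolding power2_norm_eq_inner inner_diff_left inner_diff_right inner_scaleR_left inner_scaleR_right
        inner_commute[of v y]
      by algebra
    define t where "t = inner y (x - z) / (norm y)\<^sup>2"
    have "z + t *\<^sub>R y \<in> K"
      by (simp only: scaleR_scaleC) (use that \<open>z \<in> K\<close> in \<open>simp add: add scale\<close>)
    then have "J z \<le> J (z + t *\<^sub>R y)"
      by (rule Jz)
    also have "\<dots> = (norm (x - z - t *\<^sub>R y))\<^sup>2"
      by (simp add: J_def algebra_simps)
    also have "\<dots> = J z - 2 * t * inner y (x - z) + t\<^sup>2 * (norm y)\<^sup>2"
      by (simp add: J_def expand)
    also have "\<dots> = J z - (inner y (x - z))\<^sup>2 / (norm y)\<^sup>2"
      using False by (simp add: t_def power2_eq_square field_simps)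
    finally have "(inner y (x - z))\<^sup>2 / (norm y)\<^sup>2 \<le> 0"
      by simp
    then show ?thesis
      using False by (simp add: divide_le_0_iff)
  qed simp
  have "cinner y (x - z) = 0" if "y \<in> K" for y
  proof -
    have "Re (cinner y (x - z)) = 0" "Re (cinner (\<i> *\<^sub>C y) (x - z)) = 0"
      using real_orth[OF that] real_orth[OF scale[OF that that]] by (metis inner_eq_Re_cinner)+
    then show ?thesis
      by (simp add: cinner_scaleC_left complex_eq_iff)
  qed
  with \<open>z \<in> K\<close> show ?thesis by blast
qed

definition projection_onto :: "'h::complex_hilbert bdd_op \<Rightarrow> 'h set \<Rightarrow> bool" where
  "projection_onto p K \<longleftrightarrow> adj p = p \<and> (\<forall>x. p \<cdot> x \<in> K) \<and> (\<forall>x\<in>K. p \<cdot> x = x)"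

lemma projection_onto_idem: "projection_onto p K \<Longrightarrow> p * p = p"
  by (rule bdd_op_eqI) (simp add: projection_onto_def)

lemma projection_onto_exists:
  fixes K :: "'h::complex_hilbert set"
  assumes sub: "complex_subspace K" and "closed K"
  obtains p where "projection_onto p K"
proof -
  have add: "y + y' \<in> K" and scale: "c *\<^sub>C y \<in> K" if "y \<in> K" "y' \<in> K" for y y' c
    using sub that by (auto simp: complex_subspace_def)
  have "\<forall>x. \<exists>z. z \<in> K \<and> (\<forall>y\<in>K. cinner y (x - z) = 0)"
    using orthogonal_decomposition[OF assms] by blast
  then have "\<exists>f. \<forall>x. f x \<in> K \<and> (\<forall>y\<in>K. cinner y (x - f x) = 0)"
    by (rule choice)
  then obtain f where f: "\<And>x. f x \<in> K" "\<And>x y. y \<in> K \<Longrightarrow> cinner y (x - f x) = 0"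
    by blast
  have uniq: "f x = z" if "z \<in> K" "\<And>y. y \<in> K \<Longrightarrow> cinner y (x - z) = 0" for x z
  proof -
    have d: "f x - z \<in> K"
      using f(1) that(1) sub by (simp add: complex_subspace_diff)
    have "cinner (f x - z) (f x - z) = cinner (f x - z) (x - z) - cinner (f x - z) (x - f x)"
      by (simp flip: cinner_diff_right)
    also have "\<dots> = 0"
      using d that(2) f(2) by simp
    finally show ?thesis by simp
  qed
  have "norm (f x) \<le> 1 * norm x" for x
  proof -
    have "inner (f x) (x - f x) = 0"
      using f by (simp add: inner_eq_Re_cinner)
    then have "(norm (f x))\<^sup>2 = inner (f x) x"
      by (simp add: power2_norm_eq_inner inner_diff_right)
    also have "\<dots> \<le> norm (f x) * norm x"
      by (rule norm_cauchy_schwarz)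
    finally show ?thesis
      by (cases "f x = 0") (auto simp: power2_eq_square)
  qed
  moreover have "f (x + y) = f x + f y" for x y
  proof (rule uniq)
    show "cinner w (x + y - (f x + f y)) = 0" if "w \<in> K" for w
      using f(2)[OF that, of x] f(2)[OF that, of y] by (simp add: cinner_simps)
  qed (simp add: add f)
  moreover have "f (c *\<^sub>C x) = c *\<^sub>C f x" for c x
  proof (rule uniq)
    show "cinner w (c *\<^sub>C x - c *\<^sub>C f x) = 0" if "w \<in> K" for w
      using f(2)[OF that, of x] by (simp add: cinner_simps)
  qed (use scale f in blast)
  ultimately obtain p where p: "\<And>x. p \<cdot> x = f x"
    using bdd_op_exists[of f 1] by metis
  have "cinner (f x) y = cinner x (f y)" for x y
  proof -
    have "cinner (f x) (y - f y) = 0" "cnj (cinner (f y) (x - f x)) = 0"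
      by (simp_all add: f)
    then show ?thesis
      by (simp add: cinner_simps flip: cinner_commute)
  qed
  then have "adj p = p"
    by (simp add: adj_eq_self_iff p)
  moreover have "f x = x" if "x \<in> K" for x
    using that by (intro uniq) simp_all
  ultimately have "projection_onto p K"
    by (simp add: projection_onto_def p f)
  then show thesis by (rule that)
qed

text \<open>Invariance of \<open>K\<close> under \<open>a\<close> gives
  \<open>p * a * p = a * p\<close>; invariance under \<open>adj a\<close> gives, after taking
  adjoints, \<open>p * a * p = p * a\<close>.\<close>

lemma projection_commute:
  assumes p: "projection_onto p K"
    and "\<And>x. x \<in> K \<Longrightarrow> a \<cdot> x \<in> K" "\<And>x. x \<in> K \<Longrightarrow> adj a \<cdot> x \<in> K"
  shows "a * p = p * a"
proof -
  have "p * a * p = a * p" "p * adj a * p = adj a * p"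
    using assms by (auto intro!: bdd_op_eqI simp: projection_onto_def)
  moreover have "adj (p * adj a * p) = p * a * p" "adj (adj a * p) = p * a"
    using p by (simp_all add: adj_mult mult.assoc projection_onto_def)
  ultimately show ?thesis by metis
qed

lemma complex_subspace_kernel: "complex_subspace {x. a \<cdot> x = 0}"
  and closed_kernel: "closed {x. a \<cdot> x = 0}"
  using op_apply_bounded_linear[of a]
  by (auto simp: complex_subspace_def op_apply_add op_apply_scaleC scaleC_zero_right
      intro!: closed_Collect_eq linear_continuous_on)

text \<open>
  The projection \<open>p\<close> onto the kernel of \<open>\<bar>c\<bar> + c\<close> splits the space into a part where \<open>-1 \<le> c \<le> 0\<close> and a
  part where \<open>0 \<le> c \<le> 1\<close>.
\<close>

lemma halving_projection:
  fixes c :: "'h::complex_hilbert bdd_op"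
  assumes S: "\<And>x. x \<in> S \<Longrightarrow> adj x \<in> S" and c: "c \<in> commutant S" "adj c = c"
    and contr: "\<And>x. norm (c \<cdot> x) \<le> norm x"
  obtains p where "p \<in> commutant S" "adj p = p" "p * p = p"
    "\<And>x. norm ((c + p - (1/2) *\<^sub>C 1) \<cdot> x) \<le> 1/2 * norm x"
proof -
  have "adj (1 - c * c) = 1 - c * c" "\<And>x. norm ((1 - c * c) \<cdot> x) \<le> norm x"
    using c contr contraction_one_minus_square[of c] by (simp_all add: adj_diff adj_mult)
  then obtain b where b: "adj b = b" "\<And>x. norm (b \<cdot> x) \<le> norm x" "(1 - b) * (1 - b) = c * c"
    "\<And>d. d * (1 - c * c) = (1 - c * c) * d \<Longrightarrow> d * b = b * d"
    using sqrt_one_minus[of "1 - c * c"] by auto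
  \<comment> \<open>The absolute value of \<open>c\<close>: a square root of \<open>c * c\<close>
    that commutes with everything commuting with \<open>c\<close>. It lies between \<open>0\<close>
    and \<open>1\<close>; the upper bound holds because self-adjoint operators with equal squares
    satisfy \<open>norm (a \<cdot> x) = norm (c \<cdot> x)\<close>.\<close>
  define a where "a = 1 - b"
  have a: "adj a = a" "a * a = c * c"
    using b by (simp_all add: a_def adj_diff)
  have com: "d * a = a * d" if "d * c = c * d" for d
  proof -
    have "d * (c * c) = c * c * d"
      by (metis that mult.assoc)
    then have "d * b = b * d"
      by (intro b(4)) (simp add: algebra_simps)
    then show ?thesis by (simp add: a_def algebra_simps)
  qed
  have a_range: "0 \<le> Re (cinner x (a \<cdot> x)) \<and> Re (cinner x (a \<cdot> x)) \<le> (norm x)\<^sup>2" for x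
  proof
    have "\<bar>inner x (b \<cdot> x)\<bar> \<le> norm x * norm (b \<cdot> x)"
      by (rule Cauchy_Schwarz_ineq2)
    also have "\<dots> \<le> norm x * norm x"
      by (intro mult_left_mono b) simp
    finally show "0 \<le> Re (cinner x (a \<cdot> x))"
      by (simp add: a_def inner_diff_right power2_norm_eq_inner flip: inner_eq_Re_cinner power2_eq_square)
    have "inner x (a \<cdot> x) \<le> norm x * norm (a \<cdot> x)"
      by (rule norm_cauchy_schwarz)
    also have "norm (a \<cdot> x) = norm (c \<cdot> x)"
    proof -
      have "(norm (a \<cdot> x))\<^sup>2 = (norm (c \<cdot> x))\<^sup>2"
        using norm_square_self_adjoint[of a x] norm_square_self_adjoint[of c x] a c
        by (metis op_apply_simps(4))
      then show ?thesis by (simp add: power2_eq_iff_nonneg)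
    qed
    also have "norm x * norm (c \<cdot> x) \<le> norm x * norm x"
      by (intro mult_left_mono contr) simp
    finally show "Re (cinner x (a \<cdot> x)) \<le> (norm x)\<^sup>2"
      by (simp add: inner_eq_Re_cinner power2_eq_square)
  qed
  define K where "K = {x. (a + c) \<cdot> x = 0}"
  obtain p where p: "projection_onto p K"
    using projection_onto_exists[OF complex_subspace_kernel closed_kernel] unfolding K_def by blast
  then have p_K: "(a + c) \<cdot> p \<cdot> x = 0" and p_sa: "adj p = p" and pp: "p * p = p" for x
    using projection_onto_idem[OF p] unfolding projection_onto_def K_def by blast+
  have com_p: "d * p = p * d" if "d * c = c * d" "adj d * c = c * adj d" for d
  proof (rule projection_commute[OF p])
    have "d \<cdot> x \<in> K" if "x \<in> K" "d * c = c * d" for d x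
    proof -
      have "(a + c) * d = d * (a + c)"
        using that(2) com[OF that(2)] by (simp add: algebra_simps)
      then have "(a + c) \<cdot> d \<cdot> x = d \<cdot> (a + c) \<cdot> x"
        by (metis op_apply_simps(4))
      then show ?thesis
        using that(1) by (simp add: K_def del: op_apply_simps)
    qed
    then show "\<And>x. x \<in> K \<Longrightarrow> d \<cdot> x \<in> K" "\<And>x. x \<in> K \<Longrightarrow> adj d \<cdot> x \<in> K"
      using that by blast+
  qed
  have cp: "c * p = p * c"
    by (rule com_p) (simp_all add: c)
  have ca: "c * a = a * c"
    by (rule com) simp
  have ap: "a * p = p * a"
    by (rule com_p) (simp_all add: ca a)
  show thesis
  proof
    have "d * p = p * d" if "d \<in> S" for d
      using that S c by (intro com_p) (auto simp: commutant_def)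
    then show "p \<in> commutant S"
      by (simp add: commutant_def)
    show "adj p = p" "p * p = p" by fact+
    \<comment> \<open>On the range of \<open>p\<close> this is \<open>1/2 - a\<close>, on the
      orthogonal complement \<open>a - 1/2\<close>; both have numerical range in
      [-1/2, 1/2].\<close>
    define d where "d = c + p - (1/2) *\<^sub>C 1"
    show "norm ((c + p - (1/2) *\<^sub>C 1) \<cdot> x) \<le> 1/2 * norm x" for x
      unfolding d_def[symmetric]
    proof (rule norm_le_of_numerical_range)
      show "adj d = d"
        by (simp add: d_def adj_add adj_diff adj_scaleC c p_sa)
      fix x
      define y z where "y = p \<cdot> x" and "z = x - p \<cdot> x"
      have x: "x = y + z" and py: "p \<cdot> y = y" and pz: "p \<cdot> z = 0"
        using pp by (simp_all add: y_def z_def op_apply_diff_right flip: op_apply_simps(4))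
      have cy: "c \<cdot> y = - (a \<cdot> y)"
        using p_K[of x] by (simp add: y_def eq_neg_iff_add_eq_0 add.commute)
      have cz: "c \<cdot> z = a \<cdot> z"
      proof -
        \<comment> \<open>So \<open>a - c\<close> maps into the kernel \<open>K\<close>, where
          \<open>p\<close> is the identity. As \<open>p\<close> commutes with \<open>a - c\<close>
          and kills \<open>z\<close>, also \<open>(a - c) \<cdot> z = 0\<close>.\<close>
        have "(a + c) * (a - c) = 0"
          by (simp add: algebra_simps a ca)
        then have "(a + c) \<cdot> (a - c) \<cdot> z = 0"
          by (metis op_apply_simps(4,7))
        then have "p \<cdot> (a - c) \<cdot> z = (a - c) \<cdot> z"
          using p unfolding projection_onto_def K_def by blast
        moreover have "p * (a - c) = (a - c) * p"
          by (simp add: algebra_simps ap cp)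
        then have "p \<cdot> (a - c) \<cdot> z = (a - c) \<cdot> p \<cdot> z"
          by (metis op_apply_simps(4))
        ultimately show ?thesis
          by (simp add: pz)
      qed
      have orth: "cinner (p \<cdot> v) w = 0" "cinner w (p \<cdot> v) = 0" if "p \<cdot> w = 0" for v w
        using that by (metis adj_cinner cinner_zero_right p_sa, metis adj_cinner cinner_zero_left p_sa)
      have pdy: "p \<cdot> d \<cdot> y = d \<cdot> y" and pdz: "p \<cdot> d \<cdot> z = 0"
      proof -
        have "p * d = d * p"
          by (simp add: d_def algebra_simps cp)
        then show "p \<cdot> d \<cdot> y = d \<cdot> y" "p \<cdot> d \<cdot> z = 0"
          by (metis op_apply_simps(4) py, metis op_apply_simps(4) pz op_apply_zero_right)
      qed
      have "cinner x (d \<cdot> x) = cinner y (d \<cdot> y) + cinner z (d \<cdot> z)"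
        unfolding x using orth[OF pdz, of y] orth[OF pz, of "d \<cdot> y"]
        by (simp add: op_apply_add cinner_simps py pdy)
      moreover have "cinner y (d \<cdot> y) = (norm y)\<^sup>2 / 2 - cinner y (a \<cdot> y)"
        by (simp add: d_def cy py cinner_simps cinner_self)
      moreover have "cinner z (d \<cdot> z) = cinner z (a \<cdot> z) - (norm z)\<^sup>2 / 2"
        by (simp add: d_def cz pz cinner_simps cinner_self)
      ultimately have "Re (cinner x (d \<cdot> x)) =
          (norm y)\<^sup>2 / 2 - Re (cinner y (a \<cdot> y)) + Re (cinner z (a \<cdot> z)) - (norm z)\<^sup>2 / 2"
        by (simp flip: of_real_power)
      moreover have "(norm x)\<^sup>2 = (norm y)\<^sup>2 + (norm z)\<^sup>2"
      proof -
        have "inner y z = 0"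
          using orth[OF pz, of y] by (simp add: inner_eq_Re_cinner py)
        then show ?thesis
          by (simp add: x power2_norm_eq_inner inner_simps inner_commute)
      qed
      ultimately show "\<bar>Re (cinner x (d \<cdot> x))\<bar> \<le> 1/2 * (norm x)\<^sup>2"
        unfolding abs_le_iff using a_range[of y] a_range[of z] by linarith
    qed
  qed
qed

text \<open>
  Replacing \<open>c\<close> by \<open>2 c + 2 p - 1\<close> doubles the commutator with \<open>u\<close> but keeps \<open>c\<close> a contraction, so the
  commutator has to vanish.
\<close>

lemma commute_of_commute_projections:
  fixes u :: "'h::complex_hilbert bdd_op"
  assumes S: "\<And>x. x \<in> S \<Longrightarrow> adj x \<in> S"
    and u: "\<And>p. p \<in> commutant S \<Longrightarrow> adj p = p \<Longrightarrow> p * p = p \<Longrightarrow> p * u = u * p"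
    and c: "c \<in> commutant S"
  shows "c * u = u * c"
proof -
  have contr: "c * u = u * c"
    if c: "c \<in> commutant S" "adj c = c" "\<And>x. norm (c \<cdot> x) \<le> norm x" for c
  proof -
    define w where "w = c * u - u * c"
    have step: "\<exists>c'. c' \<in> commutant S \<and> adj c' = c' \<and> (\<forall>x. norm (c' \<cdot> x) \<le> norm x) \<and>
        c' * u - u * c' = (2 ^ n) *\<^sub>C w" for n
    proof (induction n)
      case 0
      then show ?case using c by (auto simp: w_def scaleC_one)
    next
      case (Suc n)
      then obtain c' where c': "c' \<in> commutant S" "adj c' = c'" "\<And>x. norm (c' \<cdot> x) \<le> norm x"
        "c' * u - u * c' = (2 ^ n) *\<^sub>C w"
        by blast
      obtain p where p: "p \<in> commutant S" "adj p = p" "p * p = p"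
        "\<And>x. norm ((c' + p - (1/2) *\<^sub>C 1) \<cdot> x) \<le> 1/2 * norm x"
        using halving_projection[OF S c'(1-3)] by blast
      define d where "d = c' + p - (1/2) *\<^sub>C 1"
      have "d * u - u * d = c' * u - u * c'"
        using u[OF p(1-3)] by (simp add: d_def algebra_simps)
      then have "(2 *\<^sub>C d) * u - u * (2 *\<^sub>C d) = 2 *\<^sub>C (2 ^ n) *\<^sub>C w"
        by (simp add: c'(4) flip: scaleC_diff_right)
      moreover have "2 *\<^sub>C d \<in> commutant S"
        unfolding d_def by (intro commutant_ops p c')
      moreover have "adj (2 *\<^sub>C d) = 2 *\<^sub>C d"
        by (simp add: d_def adj_add adj_diff adj_scaleC p c')
      moreover have "norm ((2 *\<^sub>C d) \<cdot> x) \<le> norm x" for x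
        using p(4)[of x] by (simp add: norm_scaleC flip: d_def)
      ultimately show ?case
        by (intro exI[of _ "2 *\<^sub>C d"]) (simp add: scaleC_scaleC)
    qed
    have "w \<cdot> x = 0" for x
    proof (rule ccontr)
      obtain L where L: "\<And>x. norm (u \<cdot> x) \<le> L * norm x" "0 < L"
        using op_bounded[of u] by metis
      assume "w \<cdot> x \<noteq> 0"
      \<comment> \<open>The commutator of \<open>u\<close> with a contraction has norm at most
        \<open>2 * L * norm x\<close> at \<open>x\<close>; \<open>n\<close> is taken so large that
        \<open>2 ^ n * norm (w \<cdot> x)\<close> exceeds this.\<close>
      then obtain n where n: "2 * L * norm x / norm (w \<cdot> x) < 2 ^ n"
        using real_arch_pow[of 2] by auto
      obtain c' where c': "\<And>x. norm (c' \<cdot> x) \<le> norm x" "c' * u - u * c' = (2 ^ n) *\<^sub>C w"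
        using step[of n] by blast
      have "2 ^ n * norm (w \<cdot> x) = norm (c' \<cdot> u \<cdot> x - u \<cdot> c' \<cdot> x)"
        using arg_cong[OF c'(2), of "\<lambda>v. norm (v \<cdot> x)"] by (simp add: norm_scaleC norm_power)
      also have "\<dots> \<le> norm (c' \<cdot> u \<cdot> x) + norm (u \<cdot> c' \<cdot> x)"
        by (rule norm_triangle_ineq4)
      also have "\<dots> \<le> L * norm x + L * norm x"
        using L by (intro add_mono order_trans[OF c'(1) L(1)] order_trans[OF L(1) mult_left_mono[OF c'(1)]]) simp
      finally show False
        using n \<open>w \<cdot> x \<noteq> 0\<close> by (simp add: divide_less_eq)
    qed
    then have "w = 0"
      by (intro bdd_op_eqI) simp
    then show ?thesis by (simp add: w_def)
  qed
  have sa: "c * u = u * c" if c: "c \<in> commutant S" "adj c = c" for c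
  proof -
    obtain L where L: "0 < L" "\<And>y. norm (c \<cdot> y) \<le> L * norm y"
      using op_bounded by blast
    let ?c = "complex_of_real (1 / L) *\<^sub>C c"
    have "norm (?c \<cdot> y) \<le> norm y" for y
      using L by (simp add: norm_scaleC norm_divide field_simps)
    then have "?c * u = u * ?c"
      using c by (intro contr commutant_ops) (auto simp: adj_scaleC)
    then have "of_real L *\<^sub>C ?c * u = of_real L *\<^sub>C (u * ?c)"
      by simp
    then show ?thesis
      using L by (simp add: scaleC_scaleC scaleC_one)
  qed
  obtain a b where "a \<in> commutant S" "b \<in> commutant S" "adj a = a" "adj b = b" "c = a + \<i> *\<^sub>C b"
    using self_adjoint_decomposition[OF S c] .
  then show ?thesis
    using sa[of a] sa[of b] by (simp add: distrib_left distrib_right)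
qed

subsection \<open>Uniqueness of purifications\<close>

lemma von_neumann_algebraD:
  assumes "von_neumann_algebra M"
  shows "a \<in> M \<Longrightarrow> adj a \<in> M" and "commutant (commutant M) = M"
  using assms by (auto simp: von_neumann_algebra_def star_subalgebra_def)

lemma commutant_commute: "a \<in> commutant M \<Longrightarrow> b \<in> M \<Longrightarrow> a * b = b * a"
  by (simp add: commutant_def)

lemma norm_projection_le:
  assumes "adj p = p" "p * p = p"
  shows "norm (p \<cdot> x) \<le> norm x"
proof -
  have "(norm (p \<cdot> x))\<^sup>2 = inner x (p \<cdot> x)"
    using norm_square_self_adjoint[OF assms(1), of x] assms(2)
    by (simp add: inner_eq_Re_cinner flip: op_apply_simps(4))
  also have "\<dots> \<le> norm x * norm (p \<cdot> x)"
    by (rule norm_cauchy_schwarz)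
  finally show ?thesis
    by (cases "p \<cdot> x = 0") (auto simp: power2_eq_square)
qed

text \<open>
  \<open>a \<Phi> \<mapsto> a \<Psi>\<close> is isometric on \<open>M \<Phi>\<close>; its closure, extended by \<open>0\<close> to the orthogonal complement,
  is the partial isometry.
\<close>

lemma purification_partial_isometry:
  fixes M :: "'h::complex_hilbert bdd_op set"
  assumes M: "star_subalgebra M" and one: "1 \<in> M"
    and eq: "\<And>a. a \<in> M \<Longrightarrow> cinner \<Psi> (a \<cdot> \<Psi>) = cinner \<Phi> (a \<cdot> \<Phi>)"
  obtains v where "v \<in> commutant M" "partial_isometry v" "\<Psi> = v \<cdot> \<Phi>"
proof -
  have M_add: "a + b \<in> M" and M_scale: "c *\<^sub>C a \<in> M" and M_mult: "a * b \<in> M" and M_adj: "adj a \<in> M"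
    if "a \<in> M" "b \<in> M" for a b c
    using M that by (auto simp: star_subalgebra_def)
  have M_diff: "a - b \<in> M" if "a \<in> M" "b \<in> M" for a b
    using M_add[OF that(1) M_scale[OF that(2) that(2)], of "-1"] by (simp add: scaleC_minus_left scaleC_one)
  have iso: "norm (a \<cdot> \<Psi>) = norm (a \<cdot> \<Phi>)" if "a \<in> M" for a
  proof -
    have "cinner (a \<cdot> \<Psi>) (a \<cdot> \<Psi>) = cinner (a \<cdot> \<Phi>) (a \<cdot> \<Phi>)"
      using eq[OF M_mult[OF M_adj[OF that that] that]] by (simp add: cinner_adj_right)
    then show ?thesis
      by (simp only: inner_eq_Re_cinner norm_eq_sqrt_inner)
  qed
  \<comment> \<open>The closed graph of a \<Phi> \<mapsto> a \<Psi>, kept as a relation since a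
    \<Phi> does not determine a. Single-valuedness follows from norm preservation applied to
    differences.\<close>
  define R where "R y w \<longleftrightarrow> (\<exists>a. (\<forall>n. a n \<in> M) \<and> (\<lambda>n. a n \<cdot> \<Phi>) \<longlonglongrightarrow> y \<and> (\<lambda>n. a n \<cdot> \<Psi>) \<longlonglongrightarrow> w)" for y w
  have R_add: "R (y + y') (w + w')" if "R y w" "R y' w'" for y y' w w'
  proof -
    obtain a where a: "\<And>n::nat. a n \<in> M" "(\<lambda>n. a n \<cdot> \<Phi>) \<longlonglongrightarrow> y" "(\<lambda>n. a n \<cdot> \<Psi>) \<longlonglongrightarrow> w"
      using \<open>R y w\<close> unfolding R_def by blast
    obtain b where b: "\<And>n::nat. b n \<in> M" "(\<lambda>n. b n \<cdot> \<Phi>) \<longlonglongrightarrow> y'" "(\<lambda>n. b n \<cdot> \<Psi>) \<longlonglongrightarrow> w'"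
      using \<open>R y' w'\<close> unfolding R_def by blast
    show ?thesis
      unfolding R_def using a b
      by (intro exI[of _ "\<lambda>n. a n + b n"]) (auto intro!: M_add tendsto_add)
  qed
  have R_apply: "R (s \<cdot> y) (s \<cdot> w)" if "R y w" "s \<in> M" for s y w
  proof -
    obtain a where a: "\<And>n::nat. a n \<in> M" "(\<lambda>n. a n \<cdot> \<Phi>) \<longlonglongrightarrow> y" "(\<lambda>n. a n \<cdot> \<Psi>) \<longlonglongrightarrow> w"
      using \<open>R y w\<close> unfolding R_def by blast
    show ?thesis
      unfolding R_def using a that(2)
      by (intro exI[of _ "\<lambda>n. s * a n"]) (auto intro!: M_mult tendsto_op_apply)
  qed
  have R_scale: "R (c *\<^sub>C y) (c *\<^sub>C w)" if "R y w" for c y w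
    using R_apply[OF that M_scale[OF one one], of c] by simp
  have R_norm: "norm w = norm y" if Ryw: "R y w" for y w
  proof -
    obtain a where a: "\<And>n::nat. a n \<in> M" "(\<lambda>n. a n \<cdot> \<Phi>) \<longlonglongrightarrow> y" "(\<lambda>n. a n \<cdot> \<Psi>) \<longlonglongrightarrow> w"
      using Ryw unfolding R_def by blast
    have "(\<lambda>n. norm (a n \<cdot> \<Phi>)) \<longlonglongrightarrow> norm w"
      using tendsto_norm[OF a(3)] by (simp add: iso a(1))
    then show ?thesis
      using LIMSEQ_unique tendsto_norm[OF a(2)] by blast
  qed
  have R_unique: "w = w'" if "R y w" "R y w'" for y w w'
  proof -
    have "R (y + (-1) *\<^sub>C y) (w + (-1) *\<^sub>C w')"
      by (intro R_add R_scale that)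
    then show ?thesis
      using R_norm[of 0 "w - w'"] by (simp add: scaleC_minus_left scaleC_one)
  qed
  define K where "K = closure ((\<lambda>a. a \<cdot> \<Phi>) ` M)"
  have R_ex: "\<exists>w. R y w" if y: "y \<in> K" for y
  proof -
    have "\<exists>f. (\<forall>n::nat. f n \<in> (\<lambda>a. a \<cdot> \<Phi>) ` M) \<and> f \<longlonglongrightarrow> y"
      using y unfolding K_def closure_sequential .
    then obtain f where f: "\<And>n::nat. f n \<in> (\<lambda>a. a \<cdot> \<Phi>) ` M" "f \<longlonglongrightarrow> y"
      by blast
    then have "\<forall>n. \<exists>a. a \<in> M \<and> f n = a \<cdot> \<Phi>"
      by blast
    then obtain a where a: "\<And>n. a n \<in> M" "\<And>n. f n = a n \<cdot> \<Phi>"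
      using choice[of "\<lambda>n a. a \<in> M \<and> f n = a \<cdot> \<Phi>"] by blast
    have "Cauchy f"
      using f(2) by (rule LIMSEQ_imp_Cauchy)
    moreover have "dist (a m \<cdot> \<Psi>) (a n \<cdot> \<Psi>) = dist (f m) (f n)" for m n
      using iso[OF M_diff[OF a(1) a(1)], of m n] by (simp add: dist_norm a(2))
    ultimately have "Cauchy (\<lambda>n. a n \<cdot> \<Psi>)"
      by (simp add: Cauchy_def)
    then obtain w where "(\<lambda>n. a n \<cdot> \<Psi>) \<longlonglongrightarrow> w"
      using Cauchy_convergent convergent_def by blast
    then show ?thesis
      unfolding R_def using a f(2) by (intro exI[of _ w] exI[of _ a]) (auto simp flip: a(2))
  qed
  have K_iff: "y \<in> K \<longleftrightarrow> (\<exists>w. R y w)" for y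
  proof
    assume "\<exists>w. R y w"
    then obtain a where "\<And>n::nat. a n \<in> M" "(\<lambda>n. a n \<cdot> \<Phi>) \<longlonglongrightarrow> y"
      unfolding R_def by blast
    then show "y \<in> K"
      unfolding K_def closure_sequential by (intro exI[of _ "\<lambda>n. a n \<cdot> \<Phi>"]) auto
  qed (rule R_ex)
  have R_\<Phi>: "R \<Phi> \<Psi>"
    unfolding R_def using one by (intro exI[of _ "\<lambda>_. 1"]) auto
  have R_0: "R 0 0"
    using R_scale[OF R_\<Phi>, of 0] by simp
  have "complex_subspace K"
    unfolding complex_subspace_def
  proof (intro conjI ballI allI)
    show "0 \<in> K"
      unfolding K_iff using R_0 ..
    fix x y c
    assume "x \<in> K" "y \<in> K"
    then obtain w w' where "R x w" "R y w'"
      unfolding K_iff by (elim exE)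
    from R_add[OF this] R_scale[OF this(1), of c]
    show "x + y \<in> K" "c *\<^sub>C x \<in> K"
      unfolding K_iff by blast+
  qed
  moreover have "closed K"
    by (simp add: K_def)
  ultimately obtain p where p: "projection_onto p K"
    using projection_onto_exists by blast
  have pK: "p \<cdot> x \<in> K" for x
    using p by (simp add: projection_onto_def)
  have "\<forall>x. \<exists>w. R (p \<cdot> x) w"
    using pK K_iff by blast
  then obtain f where f: "\<And>x. R (p \<cdot> x) (f x)"
    using choice[of "\<lambda>x. R (p \<cdot> x)"] by blast
  have f_eq: "f x = w" if "R (p \<cdot> x) w" for x w
    using f that by (rule R_unique)
  have p_norm: "norm (p \<cdot> x) \<le> norm x" for x
    using p projection_onto_idem[OF p] by (intro norm_projection_le) (simp_all add: projection_onto_def)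
  obtain v where v: "\<And>x. v \<cdot> x = f x"
  proof (rule bdd_op_exists)
    show "f (x + y) = f x + f y" for x y
      by (rule f_eq) (simp add: op_apply_add R_add f)
    show "f (c *\<^sub>C x) = c *\<^sub>C f x" for c x
      by (rule f_eq) (simp add: op_apply_scaleC R_scale f)
    show "norm (f x) \<le> 1 * norm x" for x
      using p_norm[of x] R_norm[OF f, of x] by simp
  qed blast
  show thesis
  proof
    have "s * v = v * s" if s: "s \<in> M" for s
    proof (rule bdd_op_eqI)
      fix x
      have "s * p = p * s"
        using p
      proof (rule projection_commute)
        show "s \<cdot> x \<in> K" "adj s \<cdot> x \<in> K" if "x \<in> K" for x
          using that s M_adj[OF s s] R_apply unfolding K_iff by blast+
      qed
      then have "p \<cdot> s \<cdot> x = s \<cdot> p \<cdot> x"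
        by (metis op_apply_simps(4))
      then have "f (s \<cdot> x) = s \<cdot> f x"
        using R_apply[OF f s] by (intro f_eq) simp
      then show "(s * v) \<cdot> x = (v * s) \<cdot> x"
        by (simp add: v)
    qed
    then show "v \<in> commutant M"
      by (simp add: commutant_def)
    show "partial_isometry v"
      unfolding partial_isometry_def
    proof (intro allI impI)
      fix x
      assume x: "\<forall>y. v \<cdot> y = 0 \<longrightarrow> cinner y x = 0"
      have pp: "p \<cdot> p \<cdot> x = p \<cdot> x"
        using p pK by (simp add: projection_onto_def)
      \<comment> \<open>A vector orthogonal to the kernel of \<open>v\<close> is orthogonal to its
        own component \<open>x - p \<cdot> x\<close>, so it lies in \<open>K\<close>, where
        \<open>v\<close> is isometric.\<close>
      have "v \<cdot> (x - p \<cdot> x) = 0"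
        unfolding v by (rule f_eq) (simp add: op_apply_diff_right pp R_0)
      then have "cinner (x - p \<cdot> x) x = 0"
        using x by blast
      moreover have "cinner (x - p \<cdot> x) (p \<cdot> x) = 0"
        using p adj_cinner[of p "x - p \<cdot> x" x] by (simp add: projection_onto_def op_apply_diff_right pp)
      ultimately have "cinner (x - p \<cdot> x) (x - p \<cdot> x) = 0"
        by (simp only: cinner_diff_right diff_self)
      then have "p \<cdot> x = x"
        by simp
      then show "norm (v \<cdot> x) = norm x"
        using R_norm[OF f, of x] by (simp add: v)
    qed
    have "p \<cdot> \<Phi> = \<Phi>"
      using p R_\<Phi> K_iff unfolding projection_onto_def by blast
    then show "\<Psi> = v \<cdot> \<Phi>"
      using f_eq[of \<Phi> \<Psi>] R_\<Phi> by (simp add: v)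
  qed
qed

lemma unique_purifications_commutant:
  assumes "von_neumann_algebra M"
  shows "unique_purifications M (commutant M)"
proof -
  have "1 \<in> M"
    using commutant_one[of "commutant M"] von_neumann_algebraD(2)[OF assms] by simp
  moreover have "star_subalgebra M"
    using assms by (simp add: von_neumann_algebra_def)
  ultimately show ?thesis
    unfolding unique_purifications_def using purification_partial_isometry by blast
qed

text \<open>
  If \<open>u\<close> is a unitary in the commutant of \<open>MA\<close> then \<open>u \<Phi>\<close> and \<open>\<Phi>\<close> have the same marginal on \<open>MA\<close>, so
  \<open>u \<Phi> = v \<Phi>\<close> with \<open>v \<in> MB\<close> depending on \<open>\<Phi>\<close>. Hence \<open>u\<close> leaves invariant the range of every projection
  that commutes with \<open>MB\<close>.
\<close>

lemma unique_purifications_imp_commutant_subset: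
  assumes MA: "von_neumann_algebra MA" and MB: "von_neumann_algebra MB"
    and B3: "unique_purifications MA MB"
  shows "commutant MA \<subseteq> MB"
proof
  have local: "p * u * p = u * p"
    if u: "u \<in> commutant MA" "unitary u" and p: "p \<in> commutant MB" "p * p = p" for u p
  proof (rule bdd_op_eqI)
    fix x
    define y where "y = p \<cdot> x"
    have py: "p \<cdot> y = y"
      using p(2) by (simp add: y_def flip: op_apply_simps(4))
    have "p \<cdot> u \<cdot> y = u \<cdot> y"
    proof (cases "y = 0")
      case False
      define \<Phi> where "\<Phi> = complex_of_real (1 / norm y) *\<^sub>C y"
      have u_iso: "cinner (u \<cdot> x) (u \<cdot> z) = cinner x z" for x z
      proof -
        have "cinner (u \<cdot> x) (u \<cdot> z) = cinner x ((adj u * u) \<cdot> z)"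
          by (simp add: cinner_adj_right)
        then show ?thesis
          using u(2) by (simp add: unitary_def del: op_apply_simps(4))
      qed
      have n\<Phi>: "norm \<Phi> = 1"
        using False by (simp add: \<Phi>_def norm_scaleC norm_divide)
      moreover have "norm (u \<cdot> \<Phi>) = 1"
        using u_iso[of \<Phi> \<Phi>] n\<Phi> by (simp add: norm_eq_sqrt_inner inner_eq_Re_cinner)
      moreover have "cinner (u \<cdot> \<Phi>) (a \<cdot> u \<cdot> \<Phi>) = cinner \<Phi> (a \<cdot> \<Phi>)" if "a \<in> MA" for a
        using commutant_commute[OF u(1) that] u_iso by (metis op_apply_simps(4))
      ultimately obtain v where v: "v \<in> MB" "u \<cdot> \<Phi> = v \<cdot> \<Phi>"
        using B3 unfolding unique_purifications_def by blast
      have p\<Phi>: "p \<cdot> \<Phi> = \<Phi>"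
        by (simp add: \<Phi>_def op_apply_scaleC py)
      have "p \<cdot> v \<cdot> \<Phi> = v \<cdot> p \<cdot> \<Phi>"
        using commutant_commute[OF p(1) v(1)] by (metis op_apply_simps(4))
      then have "p \<cdot> u \<cdot> \<Phi> = u \<cdot> \<Phi>"
        by (simp add: v(2) p\<Phi>)
      then have "complex_of_real (norm y) *\<^sub>C (p \<cdot> u \<cdot> \<Phi>) = complex_of_real (norm y) *\<^sub>C (u \<cdot> \<Phi>)"
        by simp
      then show ?thesis
        using False by (simp add: \<Phi>_def op_apply_scaleC scaleC_scaleC scaleC_one)
    qed simp
    then show "(p * u * p) \<cdot> x = (u * p) \<cdot> x"
      by (simp add: y_def)
  qed
  have commute: "p * u = u * p"
    if u: "u \<in> commutant MA" "unitary u" and p: "p \<in> commutant MB" "adj p = p" "p * p = p" for u p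
  proof -
    \<comment> \<open>Only invariance of the range of \<open>p\<close> is known so far. Applied to
      \<open>adj u\<close> and followed by adjoints it gives the other half of commutation.\<close>
    have "adj u \<in> commutant MA" "unitary (adj u)"
      using u by (auto intro: commutant_adj von_neumann_algebraD[OF MA] simp: unitary_def)
    then have "adj (p * adj u * p) = adj (adj u * p)"
      using local p by simp
    then have "p * u * p = p * u"
      by (simp add: adj_mult p mult.assoc)
    with local[OF u p(1,3)] show ?thesis
      by simp
  qed
  have unitaries: "u \<in> MB" if u: "u \<in> commutant MA" "unitary u" for u
  proof -
    have "c * u = u * c" if "c \<in> commutant MB" for c
      using von_neumann_algebraD(1)[OF MB] commute[OF u] that by (rule commute_of_commute_projections)
    then have "u \<in> commutant (commutant MB)"
      by (simp add: commutant_def[of "commutant MB"])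
    then show ?thesis
      by (simp add: von_neumann_algebraD(2)[OF MB])
  qed
  show "a \<in> MB" if "a \<in> commutant MA" for a
    using von_neumann_algebraD(1)[OF MA] that unitaries
    by (rule commutant_unitary_induct)
      (use MB in \<open>auto simp: von_neumann_algebra_def star_subalgebra_def\<close>)
qed

subsection \<open>Operations given by conjugations\<close>

lemma vector_space_bdd_op: "vector_space (scaleC :: complex \<Rightarrow> 'h::complex_hilbert bdd_op \<Rightarrow> _)"
  by standard (simp_all add: scaleC_add_right scaleC_add_left scaleC_scaleC scaleC_one)

lemma completely_positive_conjugation: "completely_positive (\<lambda>a. adj k * a * k)"
proof -
  have "positive_matrix n (\<lambda>i j. adj k * a i j * k)" if "positive_matrix n a" for n a
    unfolding positive_matrix_def
  proof
    fix \<psi>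
    show "(\<Sum>i<n. \<Sum>j<n. cinner (\<psi> i) ((adj k * a i j * k) \<cdot> \<psi> j)) \<in> \<real>\<^sub>\<ge>\<^sub>0"
      using that[unfolded positive_matrix_def, rule_format, of "\<lambda>i. k \<cdot> \<psi> i"]
      by (simp add: cinner_adj_right)
  qed
  then show ?thesis
    by (simp add: completely_positive_def Vector_Spaces.linear_iff vector_space_bdd_op distrib_left distrib_right)
qed

text \<open>The carrier of a generated topology is the union of its subbasis; the preimage of
  \<open>UNIV\<close> under the zero functional already covers everything.\<close>

lemma topspace_ultraweak [simp]: "topspace ultraweak_topology = UNIV"
proof -
  have "openin ultraweak_topology ((\<lambda>a. \<Sum>n::nat. cinner 0 (a \<cdot> 0)) -` UNIV)"
    unfolding ultraweak_topology_def
    by (rule topology_generated_by_Basis, rule CollectI, rule exI[of _ "\<lambda>_. 0"], rule exI[of _ "\<lambda>_. 0"]) auto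
  then show ?thesis
    using openin_subset by fastforce
qed

text \<open>Conjugation pulls the functional of the sequences \<open>\<phi>\<close>,
  \<open>\<psi>\<close> back to that of \<open>k \<cdot> \<phi> n\<close>,
  \<open>k \<cdot> \<psi> n\<close>, which remain square-summable because \<open>k\<close> is
  bounded.\<close>

lemma normal_map_conjugation: "normal_map (\<lambda>a. adj k * a * k)"
  for k :: "'h::complex_hilbert bdd_op"
  unfolding normal_map_def
proof (subst (2) ultraweak_topology_def, rule continuous_on_generated_topo)
  obtain L where L: "0 < L" "\<And>x. norm (k \<cdot> x) \<le> L * norm x"
    using op_bounded by blast
  have sq: "summable (\<lambda>n. (norm (k \<cdot> \<phi> n))\<^sup>2)" if "summable (\<lambda>n::nat. (norm (\<phi> n))\<^sup>2)" for \<phi>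
  proof (rule summable_comparison_test')
    show "summable (\<lambda>n. L\<^sup>2 * (norm (\<phi> n))\<^sup>2)"
      using that by (rule summable_mult)
    show "norm ((norm (k \<cdot> \<phi> n))\<^sup>2) \<le> L\<^sup>2 * (norm (\<phi> n))\<^sup>2" if "0 \<le> n" for n
      using power_mono[OF L(2)[of "\<phi> n"], of 2] by (simp add: power_mult_distrib)
  qed
  fix U :: "'h bdd_op set"
  assume "U \<in> {(\<lambda>a. \<Sum>n. cinner (\<phi> n) (a \<cdot> \<psi> n)) -` U |\<phi> \<psi> U.
      summable (\<lambda>n::nat. (norm (\<phi> n))\<^sup>2) \<and> summable (\<lambda>n. (norm (\<psi> n))\<^sup>2) \<and> open U}"
  then obtain \<phi> \<psi> V where U: "U = (\<lambda>a. \<Sum>n. cinner (\<phi> n) (a \<cdot> \<psi> n)) -` V"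
    and s: "summable (\<lambda>n::nat. (norm (\<phi> n))\<^sup>2)" "summable (\<lambda>n. (norm (\<psi> n))\<^sup>2)" "open V"
    by blast
  have "(\<lambda>a. adj k * a * k) -` U = (\<lambda>a. \<Sum>n. cinner (k \<cdot> \<phi> n) (a \<cdot> k \<cdot> \<psi> n)) -` V"
    by (auto simp: U cinner_adj_right)
  then show "openin ultraweak_topology ((\<lambda>a. adj k * a * k) -` U \<inter> topspace ultraweak_topology)"
    by (subst topspace_ultraweak, subst Int_UNIV_right, unfold ultraweak_topology_def)
      (rule topology_generated_by_Basis, rule CollectI, intro exI conjI, assumption, (intro sq s)+)
next
  show "(\<lambda>a. adj k * a * k) ` topspace ultraweak_topology \<subseteq>
    \<Union> {(\<lambda>a. \<Sum>n. cinner (\<phi> n) (a \<cdot> \<psi> n)) -` U |\<phi> \<psi> U.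
      summable (\<lambda>n::nat. (norm (\<phi> n))\<^sup>2) \<and> summable (\<lambda>n. (norm (\<psi> n))\<^sup>2) \<and> open U}"
    unfolding topology_generated_by_topspace[symmetric] ultraweak_topology_def[symmetric] by simp
qed

section \<open>Weak sums, and instruments with one Kraus operator per outcome\<close>

lemma op_has_sum_unique: "op_has_sum f s I \<Longrightarrow> op_has_sum f t I \<Longrightarrow> s = t"
  unfolding op_has_sum_def by (intro bdd_op_cinner_eqI) (metis has_sum_unique)

lemma op_has_sum_mult: "op_has_sum f s I \<Longrightarrow> op_has_sum (\<lambda>i. a * f i * b) (a * s * b) I"
  unfolding op_has_sum_def
proof (intro allI)
  fix \<phi> \<psi>
  assume "\<forall>\<phi> \<psi>. ((\<lambda>i. cinner \<phi> (f i \<cdot> \<psi>)) has_sum cinner \<phi> (s \<cdot> \<psi>)) I"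
  from this[rule_format, of "adj a \<cdot> \<phi>" "b \<cdot> \<psi>"]
  show "((\<lambda>i. cinner \<phi> ((a * f i * b) \<cdot> \<psi>)) has_sum cinner \<phi> ((a * s * b) \<cdot> \<psi>)) I"
    by (simp add: adj_cinner)
qed

lemma op_has_sum_cong: "(\<And>i. i \<in> I \<Longrightarrow> f i = g i) \<Longrightarrow> op_has_sum f s I = op_has_sum g s I"
  unfolding op_has_sum_def by (intro iff_allI has_sum_cong) simp

lemma op_has_sum_finite: "finite I \<Longrightarrow> op_has_sum f (\<Sum>i\<in>I. f i) I"
  by (simp add: op_has_sum_def op_apply_sum cinner_sum_right)

lemma instrument_conjugations:
  assumes "finite X" "(\<Sum>x\<in>X. adj (k x) * k x) = 1"
  shows "instrument X (\<lambda>x a. adj (k x) * a * k x)"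
  using assms op_has_sum_finite[of X "\<lambda>x. adj (k x) * k x"]
  by (simp add: instrument_def completely_positive_conjugation normal_map_conjugation)

lemma inner_instrument_conjugations:
  assumes "finite X" "(\<Sum>x\<in>X. adj (k x) * k x) = 1" "\<And>x. x \<in> X \<Longrightarrow> k x \<in> N"
  shows "inner_instrument N X (\<lambda>x a. adj (k x) * a * k x)"
  unfolding inner_instrument_def
proof (intro conjI ballI instrument_conjugations assms(1,2))
  fix x
  assume "x \<in> X"
  have "op_has_sum (\<lambda>y::nat. adj (k x) * a * k x) (adj (k x) * a * k x) {0}" for a
    using op_has_sum_finite[of "{0::nat}" "\<lambda>_. adj (k x) * a * k x"] by simp
  then show "\<exists>(Y::nat set) l. (\<forall>y\<in>Y. l y \<in> N) \<and>
      (\<forall>a. op_has_sum (\<lambda>y. adj (l y) * a * l y) (adj (k x) * a * k x) Y)"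
    using \<open>x \<in> X\<close> by (intro exI[of _ "{0}"] exI[of _ "\<lambda>_. k x"]) (simp add: assms(3))
qed

text \<open>
  For a unitary \<open>u\<close> commuting with \<open>N\<close>, the operation \<open>a \<mapsto> u\<^sup>* a u\<close> commutes with all \<open>N\<close>-inner ones. If it
  is \<open>M\<close>-inner, it is a right module map over the commutant of \<open>M\<close>, i.e. \<open>u\<^sup>* c u = u\<^sup>* u c\<close> there.
\<close>

lemma can_implement_commuting_imp_commutant_subset:
  assumes M: "commutant (commutant M) = M" "star_subalgebra M"
    and N: "\<And>a. a \<in> N \<Longrightarrow> adj a \<in> N"
    and dual: "can_implement_commuting M N"
  shows "commutant N \<subseteq> M"
proof
  have unitaries: "u \<in> M" if u: "u \<in> commutant N" "unitary u" for u
  proof -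
    let ?T = "\<lambda>(x::nat) a. adj u * a * u"
    have "instrument {0} ?T"
      using u(2) by (intro instrument_conjugations) (simp_all add: unitary_def)
    moreover have "instruments_commute {0} ?T Y S" if S: "inner_instrument N Y S" for Y S
      unfolding instruments_commute_def
    proof (intro ballI ext)
      fix x y a
      assume "y \<in> Y"
      then obtain Z :: "nat set" and k where k: "\<And>z. z \<in> Z \<Longrightarrow> k z \<in> N"
        "\<And>a. op_has_sum (\<lambda>z. adj (k z) * a * k z) (S y a) Z"
        using S[unfolded inner_instrument_def, THEN conjunct2, rule_format, OF \<open>y \<in> Y\<close>] by blast
      have "adj u * (adj (k z) * a * k z) * u = adj (k z) * (adj u * a * u) * k z" if "z \<in> Z" for z
      proof -
        have "k z * u = u * k z" "adj u * adj (k z) = adj (k z) * adj u"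
          using commutant_commute[OF u(1) k(1)[OF that]] by (simp_all flip: adj_mult)
        then show ?thesis
          by (metis mult.assoc)
      qed
      then have "op_has_sum (\<lambda>z. adj (k z) * (adj u * a * u) * k z) (adj u * S y a * u) Z"
        using op_has_sum_mult[OF k(2)[of a], of "adj u" u] by (simp cong: op_has_sum_cong)
      from op_has_sum_unique[OF this k(2)] show "(?T x \<circ> S y) a = (S y \<circ> ?T x) a"
        by simp
    qed
    ultimately have "inner_instrument M {0} ?T"
      using dual unfolding can_implement_commuting_def by blast
    then obtain Z :: "nat set" and k where k: "\<And>z. z \<in> Z \<Longrightarrow> k z \<in> M"
      "\<And>a. op_has_sum (\<lambda>z. adj (k z) * a * k z) (adj u * a * u) Z"
      unfolding inner_instrument_def by auto
    have "c * u = u * c" if c: "c \<in> commutant M" for c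
    proof -
      \<comment> \<open>Summing over \<open>z\<close> compares the values at \<open>1\<close> and at
        \<open>c\<close>: the value at \<open>1\<close>, multiplied by \<open>c\<close>, is the
        value at \<open>c\<close>. The outer factor \<open>1\<close> fits the shape of
        \<open>op_has_sum_mult\<close>.\<close>
      have "1 * (adj (k z) * 1 * k z) * c = adj (k z) * c * k z" if "z \<in> Z" for z
        using commutant_commute[OF c k(1)[OF that]] by (simp add: mult.assoc)
      then have "op_has_sum (\<lambda>z. adj (k z) * c * k z) (1 * (adj u * 1 * u) * c) Z"
        using op_has_sum_mult[OF k(2)[of 1], of 1 c] by (simp cong: op_has_sum_cong)
      from op_has_sum_unique[OF this k(2)] have "adj u * c * u = c"
        using u(2) by (simp add: unitary_def)
      then have "u * (adj u * c * u) = u * c"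
        by simp
      then show ?thesis
        using u(2) unfolding unitary_def by (metis mult.assoc mult_1_left)
    qed
    then show ?thesis
      using M(1) by (auto simp: commutant_def)
  qed
  show "a \<in> M" if "a \<in> commutant N" for a
    using N that unitaries
    by (rule commutant_unitary_induct) (use M in \<open>auto simp: star_subalgebra_def\<close>)
qed

subsection \<open>Cholesky decomposition of positive kernels\<close>

text \<open>The points form a sequence that may repeat, so a pivot can be appended to any test
  family without asking whether it is new.\<close>

definition psd_kernel :: "('i \<Rightarrow> 'i \<Rightarrow> complex) \<Rightarrow> bool" where
  "psd_kernel G \<longleftrightarrow>
     (\<forall>n (q :: nat \<Rightarrow> 'i) c. (\<Sum>i<n. \<Sum>j<n. cnj (c i) * c j * G (q i) (q j)) \<in> \<real>\<^sub>\<ge>\<^sub>0)"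

lemma psd_kernel_pair:
  assumes "psd_kernel G"
  shows "cnj a * a * G p p + cnj a * b * G p q + (cnj b * a * G q p + cnj b * b * G q q) \<in> \<real>\<^sub>\<ge>\<^sub>0"
  using assms[unfolded psd_kernel_def, rule_format, where n = 2 and q = "\<lambda>i. if i = 0 then p else q"
      and c = "\<lambda>i. if i = 0 then a else b"]
  by (simp add: numeral_2_eq_2)

lemma psd_kernel_diag: "psd_kernel G \<Longrightarrow> G p p \<in> \<real>\<^sub>\<ge>\<^sub>0"
  using psd_kernel_pair[of G 1 p 0 p] by simp

text \<open>Coefficients 1, 1 make the imaginary parts of the two off-diagonal entries opposite;
  coefficients 1, \<i> make their real parts equal.\<close>

lemma psd_kernel_commute:
  assumes "psd_kernel G"
  shows "G q p = cnj (G p q)"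
proof -
  have "Im (G p p) = 0" "Im (G q q) = 0"
    using psd_kernel_diag[OF assms] by (simp_all add: complex_nonneg_Reals_iff)
  moreover have "Im (G p p + G p q + (G q p + G q q)) = 0"
    using psd_kernel_pair[OF assms, of 1 p 1 q] by (simp add: complex_nonneg_Reals_iff)
  moreover have "Im (G p p + \<i> * G p q + (- \<i> * G q p + G q q)) = 0"
    using psd_kernel_pair[OF assms, of 1 p \<i> q] by (simp add: complex_nonneg_Reals_iff)
  ultimately show ?thesis
    by (simp add: complex_eq_iff)
qed

text \<open>If the entry were some nonzero \<open>z\<close>, the coefficients \<open>- N * z\<close>
  and \<open>1\<close> would give \<open>G q q\<close> minus \<open>2 * N\<close> times the squared
  modulus of \<open>z\<close>. The chosen \<open>N\<close> makes this -\<open>G q q\<close> - 2,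
  which is negative.\<close>

lemma psd_kernel_zero:
  assumes "psd_kernel G" "G p p = 0"
  shows "G p q = 0"
proof (rule ccontr)
  define z where "z = G p q"
  assume "G p q \<noteq> 0"
  then have z: "0 < (cmod z)\<^sup>2"
    by (simp add: z_def)
  define N where "N = (Re (G q q) + 1) / (cmod z)\<^sup>2"
  let ?a = "- (of_real N * z)"
  have zz: "z * cnj z = of_real ((cmod z)\<^sup>2)"
    by (simp only: complex_norm_square)
  have "0 \<le> Re (cnj ?a * ?a * G p p + cnj ?a * 1 * G p q + (cnj 1 * ?a * G q p + cnj 1 * 1 * G q q))"
    using psd_kernel_pair[OF assms(1), of ?a p 1 q] by (simp only: complex_nonneg_Reals_iff)
  also have "cnj ?a * ?a * G p p + cnj ?a * 1 * G p q + (cnj 1 * ?a * G q p + cnj 1 * 1 * G q q) =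
      G q q - of_real (2 * N) * (z * cnj z)"
    using assms(2) by (simp add: psd_kernel_commute[OF assms(1), of q p] flip: z_def)
  also have "Re \<dots> = Re (G q q) - 2 * (N * (cmod z)\<^sup>2)"
    unfolding zz by (simp flip: of_real_mult of_real_power)
  also have "N * (cmod z)\<^sup>2 = Re (G q q) + 1"
    using z by (simp add: N_def)
  finally have "Re (G q q) \<le> -2" by simp
  then show False
    using psd_kernel_diag[OF assms(1), of q] by (simp add: complex_nonneg_Reals_iff)
qed

text \<open>For a vanishing pivot, division by zero yields the zero row; this is consistent, since
  by \<open>psd_kernel_zero\<close> nothing is left to eliminate there.\<close>

definition cholesky_row :: "'i \<Rightarrow> ('i \<Rightarrow> 'i \<Rightarrow> complex) \<Rightarrow> 'i \<Rightarrow> complex" where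
  "cholesky_row p G j = G p j / of_real (sqrt (Re (G p p)))"

lemma cholesky_row_pivot:
  assumes G: "psd_kernel G"
  shows "cnj (cholesky_row p G i) * cholesky_row p G j = G i p * G p j / G p p"
    and "cnj (cholesky_row p G i) * cholesky_row p G p = G i p"
proof -
  have pp: "G p p = of_real (Re (G p p))" "0 \<le> Re (G p p)"
    using psd_kernel_diag[OF G, of p] by (auto simp: complex_nonneg_Reals_iff complex_eq_iff)
  then have r: "complex_of_real (sqrt (Re (G p p))) * of_real (sqrt (Re (G p p))) = G p p"
    by (metis of_real_mult real_sqrt_mult_self abs_of_nonneg)
  show *: "cnj (cholesky_row p G i) * cholesky_row p G j = G i p * G p j / G p p" for j
    by (simp add: cholesky_row_def psd_kernel_commute[OF G, of i p] r)
  show "cnj (cholesky_row p G i) * cholesky_row p G p = G i p"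
    using psd_kernel_zero[OF G, of p i] psd_kernel_commute[OF G, of i p]
    by (cases "G p p = 0") (simp_all add: *)
qed

text \<open>The remainder is a Schur complement. Its form at a test family equals the form of
  \<open>G\<close> at that family enlarged by the pivot with coefficient \<open>t = - z / g\<close>,
  the minimizing choice.\<close>

lemma psd_kernel_cholesky_step:
  assumes G: "psd_kernel G"
  shows "psd_kernel (\<lambda>i j. G i j - cnj (cholesky_row p G i) * cholesky_row p G j)"
proof (cases "G p p = 0")
  case True
  then show ?thesis
    using G psd_kernel_zero[OF G True] by (simp add: cholesky_row_def)
next
  case False
  show ?thesis
    unfolding psd_kernel_def
  proof (intro allI)
    fix n :: nat and q :: "nat \<Rightarrow> 'a" and c
    define g where "g = G p p"
    define z where "z = (\<Sum>j<n. c j * G p (q j))"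
    define t where "t = - z / g"
    have g: "g \<noteq> 0" "cnj g = g"
      using False psd_kernel_commute[OF G, of p p] by (simp_all add: g_def)
    have cz: "(\<Sum>i<n. cnj (c i) * G (q i) p) = cnj z"
      by (simp add: z_def psd_kernel_commute[OF G, of "q _" p] mult.commute)
    define q' where "q' i = (if i < n then q i else p)" for i
    define c' where "c' i = (if i < n then c i else t)" for i
    have "(\<Sum>i<Suc n. \<Sum>j<Suc n. cnj (c' i) * c' j * G (q' i) (q' j)) =
        (\<Sum>i<n. (\<Sum>j<n. cnj (c i) * c j * G (q i) (q j)) + t * (cnj (c i) * G (q i) p)) +
        (cnj t * (\<Sum>j<n. c j * G p (q j)) + cnj t * t * G p p)"
      by (simp add: q'_def c'_def sum_distrib_left mult_ac)
    also have "\<dots> = (\<Sum>i<n. \<Sum>j<n. cnj (c i) * c j * G (q i) (q j)) + t * cnj z + (cnj t * z + cnj t * t * g)"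
      by (simp only: sum.distrib cz flip: sum_distrib_left z_def g_def)
    also have "\<dots> = (\<Sum>i<n. \<Sum>j<n. cnj (c i) * c j * G (q i) (q j)) - cnj z * z / g"
      using g by (simp add: t_def field_simps)
    also have "cnj z * z / g = (\<Sum>i<n. \<Sum>j<n. cnj (c i) * c j * (G (q i) p * G p (q j) / g))"
    proof -
      have "cnj z * z = (\<Sum>i<n. cnj (c i) * G (q i) p) * (\<Sum>j<n. c j * G p (q j))"
        unfolding cz by (simp add: z_def)
      also have "\<dots> = (\<Sum>i<n. \<Sum>j<n. cnj (c i) * G (q i) p * (c j * G p (q j)))"
        by (rule sum_product)
      finally show ?thesis
        by (simp add: sum_divide_distrib mult_ac)
    qed
    finally have "(\<Sum>i<Suc n. \<Sum>j<Suc n. cnj (c' i) * c' j * G (q' i) (q' j)) =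
      (\<Sum>i<n. \<Sum>j<n. cnj (c i) * c j * (G (q i) (q j) - cnj (cholesky_row p G (q i)) * cholesky_row p G (q j)))"
      unfolding g_def by (simp add: right_diff_distrib sum_subtractf cholesky_row_pivot(1)[OF G])
    moreover have "(\<Sum>i<Suc n. \<Sum>j<Suc n. cnj (c' i) * c' j * G (q' i) (q' j)) \<in> \<real>\<^sub>\<ge>\<^sub>0"
      using G unfolding psd_kernel_def by blast
    ultimately show "(\<Sum>i<n. \<Sum>j<n. cnj (c i) * c j *
        (G (q i) (q j) - cnj (cholesky_row p G (q i)) * cholesky_row p G (q j))) \<in> \<real>\<^sub>\<ge>\<^sub>0"
      by (simp only:)
  qed
qed

text \<open>
  Eliminating the pivots \<open>p 0, p 1, \<dots>\<close> one after the other clears the corresponding columns. The set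
  \<open>L\<close> allows the rows to inherit the linearity properties of the kernel.
\<close>

lemma cholesky_decomposition:
  fixes G :: "'i \<Rightarrow> 'i \<Rightarrow> complex" and p :: "nat \<Rightarrow> 'i"
  assumes G: "psd_kernel G"
    and L: "\<And>i. G i \<in> L" "\<And>f g c. f \<in> L \<Longrightarrow> g \<in> L \<Longrightarrow> (\<lambda>j. f j - c * g j) \<in> L"
      "\<And>f c. f \<in> L \<Longrightarrow> (\<lambda>j. f j / c) \<in> L"
  obtains h :: "nat \<Rightarrow> 'i \<Rightarrow> complex"
  where "\<And>N. psd_kernel (\<lambda>i j. G i j - (\<Sum>y<N. cnj (h y i) * h y j))"
    and "\<And>n N i. n < N \<Longrightarrow> G i (p n) = (\<Sum>y<N. cnj (h y i) * h y (p n))"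
    and "\<And>y. h y \<in> L"
proof -
  define R where "R = rec_nat G (\<lambda>n R i j. R i j - cnj (cholesky_row (p n) R i) * cholesky_row (p n) R j)"
  define h where "h n = cholesky_row (p n) (R n)" for n
  have R_simps: "R 0 = G" "\<And>n. R (Suc n) = (\<lambda>i j. R n i j - cnj (h n i) * h n j)"
    by (simp_all add: R_def h_def)
  have R_psd: "psd_kernel (R n)" for n
    by (induction n) (simp_all add: R_simps G h_def psd_kernel_cholesky_step)
  have R_eq: "R n i j = G i j - (\<Sum>y<n. cnj (h y i) * h y j)" for n i j
    by (induction n) (simp_all add: R_simps)
  \<comment> \<open>A cleared column stays cleared: a later row takes its value there from the
    remainder, which is already zero in that column.\<close>
  have R_zero: "R N i (p n) = 0" if "n < N" for n N i
    using that
  proof (induction N arbitrary: i)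
    case (Suc N)
    show ?case
    proof (cases "n = N")
      case True
      then show ?thesis
        using cholesky_row_pivot(2)[OF R_psd, of "p N" N i] by (simp add: R_simps h_def)
    next
      case False
      then show ?thesis
        using Suc by (simp add: R_simps h_def cholesky_row_def)
    qed
  qed simp
  have L_R: "R n i \<in> L \<and> h n \<in> L" for n i
  proof (induction n arbitrary: i)
    case 0
    show ?case
      using L(3)[OF L(1)[of "p 0"]] L(1) by (simp add: R_simps h_def cholesky_row_def[abs_def])
  next
    case (Suc n)
    then have "R (Suc n) i \<in> L" for i
      by (simp add: R_simps L(2))
    then show ?case
      by (simp add: h_def cholesky_row_def[abs_def] L(3))
  qed
  show thesis
  proof (rule that)
    show "psd_kernel (\<lambda>i j. G i j - (\<Sum>y<N. cnj (h y i) * h y j))" for N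
      using R_psd[of N] by (simp add: R_eq[abs_def])
    show "G i (p n) = (\<Sum>y<N. cnj (h y i) * h y (p n))" if "n < N" for n N i
      using R_zero[OF that, of i] by (simp add: R_eq)
    show "h y \<in> L" for y
      using L_R by blast
  qed
qed

subsection \<open>Approximate units and normal maps\<close>

lemma separable_dense_sequence:
  assumes "separable_space (euclidean :: 'h::complex_hilbert topology)"
  obtains d :: "nat \<Rightarrow> 'h::complex_hilbert" where "\<And>x \<epsilon>. 0 < \<epsilon> \<Longrightarrow> \<exists>i. norm (x - d i) < \<epsilon>"
proof -
  obtain C :: "'h set" where C: "countable C" "closure C = UNIV"
    using assms by (auto simp: separable_space_def)
  then have "C \<noteq> {}" by auto
  show thesis
  proof (rule that)
    fix x :: 'h and \<epsilon> :: real
    assume "0 < \<epsilon>"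
    moreover have "x \<in> closure C"
      using C(2) by simp
    ultimately obtain y where y: "y \<in> C" "dist y x < \<epsilon>"
      by (meson closure_approachable)
    then obtain i where "from_nat_into C i = y"
      using from_nat_into_surj[OF C(1)] by blast
    then show "\<exists>i. norm (x - from_nat_into C i) < \<epsilon>"
      using y(2) by (auto simp: dist_norm norm_minus_commute)
  qed
qed

section \<open>Rank one operators and finite rank approximation\<close>

lemma ket_add_right: "ket x (y + z) = ket x y + ket x z"
  by (rule bdd_op_eqI) (simp add: cinner_simps scaleC_add_left)

lemma ket_scaleC_right: "ket x (c *\<^sub>C y) = cnj c *\<^sub>C ket x y"
  by (rule bdd_op_eqI) (simp add: cinner_simps scaleC_scaleC)

lemma adj_ket: "adj (ket x y) = ket y x"
  by (rule adj_eqI) (simp add: cinner_simps flip: cinner_commute)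

lemma mult_ket: "a * ket x y = ket (a \<cdot> x) y"
  by (rule bdd_op_eqI) (simp add: op_apply_scaleC)

lemma ket_mult: "ket x y * a = ket x (adj a \<cdot> y)"
  by (rule bdd_op_eqI) (simp add: adj_cinner)

lemma ket_zero [simp]: "ket 0 x = 0" "ket x 0 = 0"
  by (rule bdd_op_eqI; simp add: scaleC_zero_right)+

definition ket_sum :: "(nat \<Rightarrow> 'h::complex_hilbert) \<Rightarrow> nat \<Rightarrow> 'h bdd_op" where
  "ket_sum e n = (\<Sum>i<n. ket (e i) (e i))"

text \<open>Gram--Schmidt applied to a dense sequence; the vectors \<open>e i\<close> may be zero.\<close>

lemma approximate_unit:
  assumes "separable_space (euclidean :: 'h::complex_hilbert topology)"
  obtains e :: "nat \<Rightarrow> 'h::complex_hilbert"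
  where "\<And>n. adj (ket_sum e n) = ket_sum e n" "\<And>n x. norm (ket_sum e n \<cdot> x) \<le> norm x"
    and "\<And>x. (\<lambda>n. ket_sum e n \<cdot> x) \<longlonglongrightarrow> x"
proof -
  obtain d :: "nat \<Rightarrow> 'h" where d: "\<And>x \<epsilon>. 0 < \<epsilon> \<Longrightarrow> \<exists>i. norm (x - d i) < \<epsilon>"
    using separable_dense_sequence[OF assms] by blast
  \<comment> \<open>The normalized part of \<open>d n\<close> orthogonal to the range of
    \<open>p\<close>; since \<open>inverse 0 = 0\<close>, it is the zero vector when
    \<open>d n\<close> already lies in that range.\<close>
  define f where "f n p = complex_of_real (inverse (norm (d n - p \<cdot> d n))) *\<^sub>C (d n - p \<cdot> d n)" for n p
  define P where "P = rec_nat 0 (\<lambda>n p. p + ket (f n p) (f n p))"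
  define e where "e n = f n (P n)" for n
  have P_simps: "P 0 = 0" "\<And>n. P (Suc n) = P n + ket (e n) (e n)"
    by (simp_all add: P_def e_def)
  have P_sum: "ket_sum e n = P n" for n
    by (induction n) (simp_all add: P_simps ket_sum_def)
  have P: "adj (P n) = P n \<and> P n * P n = P n \<and> (\<forall>i<n. P n \<cdot> d i = d i)" for n
  proof (induction n)
    case (Suc n)
    define w where "w = d n - P n \<cdot> d n"
    have e: "e n = complex_of_real (inverse (norm w)) *\<^sub>C w"
      by (simp add: e_def f_def w_def)
    have PP: "P n \<cdot> P n \<cdot> x = P n \<cdot> x" for x
      using Suc by (metis op_apply_simps(4))
    have Pw: "P n \<cdot> w = 0"
      by (simp add: w_def op_apply_diff_right PP)
    then have Pe: "P n \<cdot> e n = 0"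
      by (simp add: e op_apply_scaleC scaleC_zero_right)
    have e_orth: "cinner (e n) (P n \<cdot> x) = 0" for x
      using adj_cinner[of "P n" "e n" x] Suc Pe by simp
    \<comment> \<open>True for unit vectors and for the zero vector alike, so degenerate
      Gram-Schmidt steps need no separate treatment in the idempotence of
      \<open>P (Suc n)\<close>.\<close>
    have ee: "cinner (e n) (e n) *\<^sub>C e n = e n"
      by (cases "w = 0") (simp_all add: e cinner_self norm_scaleC norm_inverse scaleC_zero_right scaleC_one)
    have ed: "cinner (e n) (d n) *\<^sub>C e n = w"
    proof (cases "w = 0")
      case False
      have "cinner w (P n \<cdot> d n) = 0"
        using adj_cinner[of "P n" w "d n"] Suc Pw by simp
      then have "cinner w (d n) = cinner w w"
        by (simp add: w_def cinner_diff_right)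
      then show ?thesis
        using False by (simp add: e cinner_simps cinner_self power2_eq_square scaleC_scaleC scaleC_one mult.assoc)
    qed (simp add: e scaleC_zero_right)
    have "adj (P (Suc n)) = P (Suc n)"
      using Suc by (simp add: P_simps adj_add adj_ket)
    moreover have "P (Suc n) * P (Suc n) = P (Suc n)"
      using Suc by (simp add: P_simps distrib_left distrib_right mult_ket ket_mult Pe ee)
    moreover have "P (Suc n) \<cdot> d i = d i" if "i < Suc n" for i
    proof (cases "i = n")
      case True
      then show ?thesis by (simp add: P_simps ed) (simp add: w_def)
    next
      case False
      then have "P n \<cdot> d i = d i"
        using Suc that by simp
      then show ?thesis
        using e_orth[of "d i"] by (simp add: P_simps)
    qed
    ultimately show ?case by blast
  qed (simp add: P_simps)
  have contr: "norm (P n \<cdot> x) \<le> norm x" for n x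
    using P by (intro norm_projection_le) auto
  show thesis
  proof (rule that[of e], unfold P_sum)
    show "adj (P n) = P n" "norm (P n \<cdot> x) \<le> norm x" for n x
      using P contr by blast+
    show "(\<lambda>n. P n \<cdot> x) \<longlonglongrightarrow> x" for x
    proof (rule metric_LIMSEQ_I)
      fix r :: real
      assume "0 < r"
      then obtain i where i: "norm (x - d i) < r / 2"
        using d[of "r / 2" x] by auto
      have "dist (P n \<cdot> x) x < r" if "n \<ge> Suc i" for n
      proof -
        have "P n \<cdot> d i = d i"
          using P[of n] that by simp
        then have "P n \<cdot> x - x = P n \<cdot> (x - d i) - (x - d i)"
          by (simp add: op_apply_diff_right)
        then have "norm (P n \<cdot> x - x) \<le> norm (P n \<cdot> (x - d i)) + norm (x - d i)"
          by (simp only: norm_triangle_ineq4)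
        then show ?thesis
          using contr[of n "x - d i"] i by (simp add: dist_norm)
      qed
      then show "\<exists>no. \<forall>n\<ge>no. dist (P n \<cdot> x) x < r" by blast
    qed
  qed
qed

text \<open>Dominated convergence for series: the terms are majorized by
  \<open>K * (norm (\<phi> k) * norm (\<psi> k))\<close> uniformly in \<open>n\<close>.\<close>

lemma tendsto_suminf_cinner:
  assumes s: "summable (\<lambda>k. norm (\<phi> k) * norm (\<psi> k))"
    and bound: "\<And>n x. norm (a n \<cdot> x) \<le> K * norm x"
    and lim: "\<And>x. (\<lambda>n. a n \<cdot> x) \<longlonglongrightarrow> b \<cdot> x"
  shows "(\<lambda>n. \<Sum>k. cinner (\<phi> k) (a n \<cdot> \<psi> k)) \<longlonglongrightarrow> (\<Sum>k. cinner (\<phi> k) (b \<cdot> \<psi> k))"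
proof -
  have le: "norm (cinner (\<phi> k) (a n \<cdot> \<psi> k)) \<le> K * (norm (\<phi> k) * norm (\<psi> k))" for n k
    using order_trans[OF norm_cinner_le mult_left_mono[OF bound norm_ge_zero]]
    by (simp add: mult_ac)
  have "eventually (\<lambda>n. summable (\<lambda>k. norm (cinner (\<phi> k) (a n \<cdot> \<psi> k)))) sequentially \<and>
      summable (\<lambda>k. norm (cinner (\<phi> k) (b \<cdot> \<psi> k))) \<and>
      (\<lambda>n. \<Sum>k. cinner (\<phi> k) (a n \<cdot> \<psi> k)) \<longlonglongrightarrow> (\<Sum>k. cinner (\<phi> k) (b \<cdot> \<psi> k))"
    by (rule tannerys_theorem[where M = "\<lambda>k. K * (norm (\<phi> k) * norm (\<psi> k))"])
      (auto intro!: tendsto_cinner lim summable_mult s eventuallyI simp: le)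
  then show ?thesis by blast
qed

text \<open>On norm-bounded sequences strong convergence implies ultraweak convergence. Induction
  over the generation of open sets reduces this to the subbasis.\<close>

lemma limitin_ultraweak:
  fixes a :: "nat \<Rightarrow> 'h::complex_hilbert bdd_op"
  assumes bound: "\<And>n x. norm (a n \<cdot> x) \<le> K * norm x" and lim: "\<And>x. (\<lambda>n. a n \<cdot> x) \<longlonglongrightarrow> b \<cdot> x"
  shows "limitin ultraweak_topology a b sequentially"
  unfolding limitin_def
proof (intro conjI allI impI)
  fix U
  assume "openin ultraweak_topology U \<and> b \<in> U"
  then have "generate_topology_on {(\<lambda>a. \<Sum>n. cinner (\<phi> n) (a \<cdot> \<psi> n)) -` U |\<phi> \<psi> U.
      summable (\<lambda>n::nat. (norm (\<phi> n))\<^sup>2) \<and> summable (\<lambda>n. (norm (\<psi> n))\<^sup>2) \<and> open U} U" and "b \<in> U"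
    by (auto simp: ultraweak_topology_def dest: openin_topology_generated_by)
  then show "\<forall>\<^sub>F n in sequentially. a n \<in> U"
  proof (induction rule: generate_topology_on.induct)
    case (Int U V)
    then show ?case by (simp add: eventually_conj)
  next
    case (UN \<U>)
    then obtain U where U: "U \<in> \<U>" "b \<in> U" by blast
    with UN have "\<forall>\<^sub>F n in sequentially. a n \<in> U" by blast
    then show ?case
      by (rule eventually_mono) (use U(1) in blast)
  next
    case (Basis U)
    then obtain \<phi> \<psi> V where U: "U = (\<lambda>a. \<Sum>n. cinner (\<phi> n) (a \<cdot> \<psi> n)) -` V"
      and s: "summable (\<lambda>n::nat. (norm (\<phi> n))\<^sup>2)" "summable (\<lambda>n. (norm (\<psi> n))\<^sup>2)" "open V"
      by blast
    have "summable (\<lambda>n. norm (\<phi> n) * norm (\<psi> n))"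
    proof (rule summable_comparison_test')
      show "summable (\<lambda>n. (norm (\<phi> n))\<^sup>2 + (norm (\<psi> n))\<^sup>2)"
        using s by (intro summable_add)
      show "norm (norm (\<phi> n) * norm (\<psi> n)) \<le> (norm (\<phi> n))\<^sup>2 + (norm (\<psi> n))\<^sup>2" if "0 \<le> n" for n
      proof -
        have "0 \<le> (norm (\<phi> n) - norm (\<psi> n))\<^sup>2 + ((norm (\<phi> n))\<^sup>2 + (norm (\<psi> n))\<^sup>2)"
          by simp
        then show ?thesis
          by (simp add: power2_diff)
      qed
    qed
    from tendsto_suminf_cinner[OF this bound lim] show ?case
      using Basis(2) s(3) by (simp add: U topological_tendstoD)
  qed simp
qed simp

text \<open>A single matrix element is an ultraweakly continuous functional, given by sequences
  supported at index 0. This is the form in which normality enters the Kraus decomposition.\<close>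

lemma normal_map_tendsto:
  fixes a :: "nat \<Rightarrow> 'h::complex_hilbert bdd_op"
  assumes T: "normal_map T"
    and bound: "\<And>n x. norm (a n \<cdot> x) \<le> K * norm x" and lim: "\<And>x. (\<lambda>n. a n \<cdot> x) \<longlonglongrightarrow> b \<cdot> x"
  shows "(\<lambda>n. cinner \<phi> (T (a n) \<cdot> \<psi>)) \<longlonglongrightarrow> cinner \<phi> (T b \<cdot> \<psi>)"
proof (rule topological_tendstoI)
  fix V
  assume V: "open V" "cinner \<phi> (T b \<cdot> \<psi>) \<in> V"
  let ?\<phi> = "\<lambda>n::nat. if n = 0 then \<phi> else 0" and ?\<psi> = "\<lambda>n::nat. if n = 0 then \<psi> else 0"
  have single: "(\<Sum>n. cinner (?\<phi> n) (c \<cdot> ?\<psi> n)) = cinner \<phi> (c \<cdot> \<psi>)" for c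
    by (subst suminf_finite[of "{0}"]) auto
  have sq: "summable (\<lambda>n. (norm (if n = 0 then x else 0))\<^sup>2)" for x :: 'h
    by (rule summable_finite[of "{0}"]) auto
  have "openin ultraweak_topology ((\<lambda>c. \<Sum>n. cinner (?\<phi> n) (c \<cdot> ?\<psi> n)) -` V)"
    unfolding ultraweak_topology_def
    by (rule topology_generated_by_Basis, rule CollectI, intro exI conjI, rule refl) (rule sq V)+
  then have "openin ultraweak_topology ((\<lambda>c. cinner \<phi> (c \<cdot> \<psi>)) -` V)"
    by (simp only: single)
  moreover have "limitin ultraweak_topology (T \<circ> a) (T b) sequentially"
    using T limitin_ultraweak[OF bound lim] unfolding normal_map_def by (rule continuous_map_limit)
  ultimately show "\<forall>\<^sub>F n in sequentially. cinner \<phi> (T (a n) \<cdot> \<psi>) \<in> V"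
    using V(2) by (auto simp: limitin_def)
qed

subsection \<open>Kraus decompositions\<close>

lemma completely_positive_linear:
  assumes "completely_positive T"
  shows "T (a + b) = T a + T b" "T (c *\<^sub>C a) = c *\<^sub>C T a" "T (a - b) = T a - T b" "T 0 = 0"
    "T (\<Sum>i\<in>I. f i) = (\<Sum>i\<in>I. T (f i))"
proof -
  show add: "T (a + b) = T a + T b" and scale: "T (c *\<^sub>C a) = c *\<^sub>C T a" for a b c
    using assms by (simp_all add: completely_positive_def Vector_Spaces.linear_iff)
  show "T (a - b) = T a - T b"
    using add[of "a - b" b] by simp
  show zero: "T 0 = 0"
    using add[of 0 0] by simp
  show "T (\<Sum>i\<in>I. f i) = (\<Sum>i\<in>I. T (f i))"
    by (induction I rule: infinite_finite_induct) (simp_all add: add zero)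
qed

lemma completely_positive_mono:
  assumes T: "completely_positive T" and le: "\<And>\<psi>. cinner \<psi> ((b - a) \<cdot> \<psi>) \<in> \<real>\<^sub>\<ge>\<^sub>0"
  shows "Re (cinner \<psi> (T a \<cdot> \<psi>)) \<le> Re (cinner \<psi> (T b \<cdot> \<psi>))"
proof -
  have "positive_matrix 1 (\<lambda>_ _. b - a)"
    using le by (simp add: positive_matrix_def del: op_apply_simps)
  then have "positive_matrix 1 (\<lambda>_ _. T (b - a))"
    using T unfolding completely_positive_def by blast
  then have "cinner \<psi> (T (b - a) \<cdot> \<psi>) \<in> \<real>\<^sub>\<ge>\<^sub>0"
    unfolding positive_matrix_def by (drule_tac x = "\<lambda>_. \<psi>" in spec) simp
  then show ?thesis
    by (simp add: completely_positive_linear[OF T] cinner_simps complex_nonneg_Reals_iff)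
qed

text \<open>The quadratic form is the squared modulus of \<open>z\<close>, the sum of the inner
  products of \<open>\<xi> j\<close> with \<open>\<psi> j\<close>.\<close>

lemma positive_matrix_ket: "positive_matrix n (\<lambda>i j. ket (\<xi> i) (\<xi> j))"
  unfolding positive_matrix_def
proof
  fix \<psi>
  define z where "z = (\<Sum>j<n. cinner (\<xi> j) (\<psi> j))"
  have "(\<Sum>i<n. \<Sum>j<n. cinner (\<psi> i) (ket (\<xi> i) (\<xi> j) \<cdot> \<psi> j)) = cnj z * z"
    by (simp add: z_def cinner_simps sum_product mult_ac flip: cinner_commute)
  also have "\<dots> = of_real ((cmod z)\<^sup>2)"
    by (simp only: complex_norm_square mult.commute)
  also have "\<dots> \<in> \<real>\<^sub>\<ge>\<^sub>0"
    by (simp only: complex_nonneg_Reals_iff Re_complex_of_real Im_complex_of_real) simp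
  finally show "(\<Sum>i<n. \<Sum>j<n. cinner (\<psi> i) (ket (\<xi> i) (\<xi> j) \<cdot> \<psi> j)) \<in> \<real>\<^sub>\<ge>\<^sub>0" .
qed

text \<open>The analogue of the Choi matrix. If \<open>T\<close> has Kraus operators
  \<open>k y\<close>, this kernel is the sum over \<open>y\<close> of \<open>cnj (cinner \<xi> (k y
  \<cdot> \<phi>)) * cinner \<eta> (k y \<cdot> \<psi>)\<close> at the pairs
  \<open>(\<xi>, \<phi>)\<close> and \<open>(\<eta>, \<psi>)\<close>; so its Cholesky rows should be
  the matrix elements of Kraus operators.\<close>

definition choi_kernel ::
  "('h::complex_hilbert bdd_op \<Rightarrow> 'h bdd_op) \<Rightarrow> 'h \<times> 'h \<Rightarrow> 'h \<times> 'h \<Rightarrow> complex" where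
  "choi_kernel T p q = cinner (snd p) (T (ket (fst p) (fst q)) \<cdot> snd q)"

lemma psd_choi_kernel:
  assumes T: "completely_positive T"
  shows "psd_kernel (choi_kernel T)"
  unfolding psd_kernel_def
proof (intro allI)
  fix n :: nat and q :: "nat \<Rightarrow> 'a \<times> 'a" and c
  have "positive_matrix n (\<lambda>i j. T (ket (fst (q i)) (fst (q j))))"
    using T positive_matrix_ket[of n "\<lambda>i. fst (q i)"] by (simp add: completely_positive_def)
  then show "(\<Sum>i<n. \<Sum>j<n. cnj (c i) * c j * choi_kernel T (q i) (q j)) \<in> \<real>\<^sub>\<ge>\<^sub>0"
    unfolding positive_matrix_def
    by (drule_tac x = "\<lambda>i. c i *\<^sub>C snd (q i)" in spec)
      (simp add: choi_kernel_def cinner_simps op_apply_scaleC mult_ac)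
qed

text \<open>By Cauchy-Schwarz \<open>ket \<eta> \<eta>\<close> is at most the squared norm of
  \<open>\<eta>\<close> times the identity, and \<open>T\<close> is monotone. This bounds the
  Cholesky rows.\<close>

lemma choi_kernel_diag_le:
  assumes T: "completely_positive T"
  shows "Re (choi_kernel T (\<eta>, \<psi>) (\<eta>, \<psi>)) \<le> (norm \<eta>)\<^sup>2 * Re (cinner \<psi> (T 1 \<cdot> \<psi>))"
proof -
  have "cinner \<phi> ((complex_of_real ((norm \<eta>)\<^sup>2) *\<^sub>C 1 - ket \<eta> \<eta>) \<cdot> \<phi>) \<in> \<real>\<^sub>\<ge>\<^sub>0" for \<phi>
  proof -
    have "cinner \<eta> \<phi> * cinner \<phi> \<eta> = of_real ((cmod (cinner \<eta> \<phi>))\<^sup>2)"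
      by (simp only: complex_norm_square cinner_commute[of \<phi> \<eta>])
    moreover have "(cmod (cinner \<eta> \<phi>))\<^sup>2 \<le> (norm \<eta>)\<^sup>2 * (norm \<phi>)\<^sup>2"
      using power_mono[OF norm_cinner_le[of \<eta> \<phi>] norm_ge_zero, of 2] by (simp add: power_mult_distrib)
    ultimately show ?thesis
      by (simp add: cinner_simps cinner_self complex_nonneg_Reals_iff flip: of_real_mult of_real_power)
  qed
  from completely_positive_mono[OF T this, of \<psi>] show ?thesis
    by (simp add: choi_kernel_def completely_positive_linear[OF T] cinner_simps flip: of_real_power)
qed

lemma ket_sum_sandwich:
  "ket_sum e n * a * ket_sum e n = (\<Sum>i<n. \<Sum>j<n. cinner (e i) (a \<cdot> e j) *\<^sub>C ket (e i) (e j))"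
proof -
  have "ket (e i) (e i) * a * ket (e j) (e j) = cinner (e i) (a \<cdot> e j) *\<^sub>C ket (e i) (e j)" for i j
    by (rule bdd_op_eqI) (simp add: op_apply_scaleC scaleC_scaleC mult.commute)
  then show ?thesis
    by (subst sum.swap) (simp add: ket_sum_def sum_distrib_right sum_distrib_left)
qed

lemma kraus_decomposition:
  fixes T :: "'h::complex_hilbert bdd_op \<Rightarrow> 'h bdd_op"
  assumes sep: "separable_space (euclidean :: 'h topology)"
    and T: "completely_positive T" and normal: "normal_map T"
  obtains k :: "nat \<Rightarrow> 'h bdd_op" where "\<And>a. op_has_sum (\<lambda>y. adj (k y) * a * k y) (T a) UNIV"
proof -
  obtain d :: "nat \<Rightarrow> 'h" where d: "\<And>x \<epsilon>. 0 < \<epsilon> \<Longrightarrow> \<exists>i. norm (x - d i) < \<epsilon>"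
    using separable_dense_sequence[OF sep] by blast
  obtain e :: "nat \<Rightarrow> 'h"
    where P_adj: "\<And>n. adj (ket_sum e n) = ket_sum e n" and P_contr: "\<And>n x. norm (ket_sum e n \<cdot> x) \<le> norm x"
      and P_lim: "\<And>x. (\<lambda>n. ket_sum e n \<cdot> x) \<longlonglongrightarrow> x"
    using approximate_unit[OF sep] by blast
  note T_lin = completely_positive_linear[OF T]
  define t where "t \<psi> = Re (cinner \<psi> (T 1 \<cdot> \<psi>))" for \<psi>
  obtain C where C: "0 < C" "\<And>\<psi>. t \<psi> \<le> C\<^sup>2 * (norm \<psi>)\<^sup>2"
  proof -
    obtain L where L: "0 < L" "\<And>x. norm (T 1 \<cdot> x) \<le> L * norm x"
      using op_bounded by blast
    have "t \<psi> \<le> (sqrt L)\<^sup>2 * (norm \<psi>)\<^sup>2" for \<psi>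
    proof -
      have "t \<psi> \<le> norm \<psi> * norm (T 1 \<cdot> \<psi>)"
        unfolding t_def by (metis inner_eq_Re_cinner norm_cauchy_schwarz)
      also have "\<dots> \<le> norm \<psi> * (L * norm \<psi>)"
        by (intro mult_left_mono L) simp
      finally show ?thesis
        using L(1) by (simp add: power2_eq_square mult_ac)
    qed
    then show thesis
      using L(1) by (intro that[of "sqrt L"]) auto
  qed
  \<comment> \<open>Finite rank compressions involve only the vectors \<open>e j\<close>, so the
    first components of the pivots can be restricted to them; the second components must be dense.
    Pivots clear whole columns, so \<open>\<phi>\<close> on the left stays arbitrary.\<close>
  define p where "p n = (e (fst (prod_decode n)), d (snd (prod_decode n)))" for n
  define L where "L = {f :: 'h \<times> 'h \<Rightarrow> complex.
    (\<forall>x y z. f (x + y, z) = f (x, z) + f (y, z)) \<and> (\<forall>c x z. f (c *\<^sub>C x, z) = cnj c * f (x, z)) \<and>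
    (\<forall>x y z. f (x, y + z) = f (x, y) + f (x, z)) \<and> (\<forall>c x z. f (x, c *\<^sub>C z) = c * f (x, z))}"
  obtain h where h_psd: "\<And>N. psd_kernel (\<lambda>i j. choi_kernel T i j - (\<Sum>y<N. cnj (h y i) * h y j))"
    and h_pivot: "\<And>n N i. n < N \<Longrightarrow> choi_kernel T i (p n) = (\<Sum>y<N. cnj (h y i) * h y (p n))"
    and h_L: "\<And>y. h y \<in> L"
  proof (rule cholesky_decomposition[OF psd_choi_kernel[OF T], where p = p and L = L])
    show "choi_kernel T i \<in> L" for i
      by (simp add: L_def choi_kernel_def ket_add_right ket_scaleC_right T_lin cinner_simps
          op_apply_add op_apply_scaleC)
    show "(\<lambda>j. f j - c * g j) \<in> L" if "f \<in> L" "g \<in> L" for f g c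
      using that by (simp add: L_def algebra_simps)
    show "(\<lambda>j. f j / c) \<in> L" if "f \<in> L" for f c
      using that by (simp add: L_def add_divide_distrib)
  qed blast
  have h_sum_le: "(\<Sum>y<N. (cmod (h y q))\<^sup>2) \<le> Re (choi_kernel T q q)" for N q
  proof -
    have "0 \<le> Re (choi_kernel T q q - (\<Sum>y<N. cnj (h y q) * h y q))"
      using psd_kernel_diag[OF h_psd[of N], of q] by (simp add: complex_nonneg_Reals_iff)
    also have "(\<Sum>y<N. cnj (h y q) * h y q) = of_real (\<Sum>y<N. (cmod (h y q))\<^sup>2)"
      by (simp only: of_real_sum complex_norm_square mult.commute)
    finally show ?thesis by simp
  qed
  \<comment> \<open>A single row is dominated by the diagonal of the kernel; the resulting bound
    makes it the form of a bounded operator.\<close>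
  have h_le: "cmod (h y (\<eta>, \<psi>)) \<le> C * norm \<eta> * norm \<psi>" for y \<eta> \<psi>
  proof (rule power2_le_imp_le)
    have "(cmod (h y (\<eta>, \<psi>)))\<^sup>2 \<le> (\<Sum>y<Suc y. (cmod (h y (\<eta>, \<psi>)))\<^sup>2)"
      by (simp add: sum_nonneg)
    also have "\<dots> \<le> Re (choi_kernel T (\<eta>, \<psi>) (\<eta>, \<psi>))"
      by (rule h_sum_le)
    also have "\<dots> \<le> (norm \<eta>)\<^sup>2 * t \<psi>"
      unfolding t_def by (rule choi_kernel_diag_le[OF T])
    also have "\<dots> \<le> (norm \<eta>)\<^sup>2 * (C\<^sup>2 * (norm \<psi>)\<^sup>2)"
      by (intro mult_left_mono C) simp
    finally show "(cmod (h y (\<eta>, \<psi>)))\<^sup>2 \<le> (C * norm \<eta> * norm \<psi>)\<^sup>2"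
      by (simp add: power_mult_distrib mult_ac)
  qed (use C in simp)
  have "\<exists>k. \<forall>\<eta> \<psi>. cinner \<eta> (k \<cdot> \<psi>) = h y (\<eta>, \<psi>)" for y
  proof -
    have "\<And>x w z. h y (x + w, z) = h y (x, z) + h y (w, z)" "\<And>c x z. h y (c *\<^sub>C x, z) = cnj c * h y (x, z)"
      "\<And>x w z. h y (x, w + z) = h y (x, w) + h y (x, z)" "\<And>c x z. h y (x, c *\<^sub>C z) = c * h y (x, z)"
      using h_L[of y] by (simp_all add: L_def)
    from sesquilinear_form_op[of "\<lambda>x z. h y (x, z)", OF this h_le] show ?thesis
      by blast
  qed
  then have "\<exists>k. \<forall>y \<eta> \<psi>. cinner \<eta> (k y \<cdot> \<psi>) = h y (\<eta>, \<psi>)"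
    by (intro choice allI)
  then obtain k where k: "\<And>y \<eta> \<psi>. cinner \<eta> (k y \<cdot> \<psi>) = h y (\<eta>, \<psi>)"
    by blast
  \<comment> \<open>Norms are approximated by the components along \<open>e i\<close>. Exchanging
    the finite sums leaves diagonal values of the kernel, which add up to
    \<open>T (ket_sum e n)\<close>, and this is dominated by \<open>T 1\<close>.\<close>
  have k_sum_le: "(\<Sum>y<N. (norm (k y \<cdot> \<psi>))\<^sup>2) \<le> t \<psi>" for N \<psi>
  proof (rule LIMSEQ_le_const2)
    show "(\<lambda>n. \<Sum>y<N. Re (cinner (k y \<cdot> \<psi>) (ket_sum e n \<cdot> k y \<cdot> \<psi>))) \<longlonglongrightarrow> (\<Sum>y<N. (norm (k y \<cdot> \<psi>))\<^sup>2)"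
    proof (intro tendsto_sum)
      fix y
      have "(\<lambda>n. Re (cinner (k y \<cdot> \<psi>) (ket_sum e n \<cdot> k y \<cdot> \<psi>))) \<longlonglongrightarrow> Re (cinner (k y \<cdot> \<psi>) (k y \<cdot> \<psi>))"
        by (intro tendsto_intros tendsto_cinner P_lim)
      then show "(\<lambda>n. Re (cinner (k y \<cdot> \<psi>) (ket_sum e n \<cdot> k y \<cdot> \<psi>))) \<longlonglongrightarrow> (norm (k y \<cdot> \<psi>))\<^sup>2"
        by (simp add: power2_norm_eq_inner inner_eq_Re_cinner)
    qed
    have "(\<Sum>y<N. Re (cinner (k y \<cdot> \<psi>) (ket_sum e n \<cdot> k y \<cdot> \<psi>))) \<le> t \<psi>" for n
    proof -
      have "cinner x (ket_sum e n \<cdot> x) = of_real (\<Sum>i<n. (cmod (cinner (e i) x))\<^sup>2)" for x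
        by (simp only: ket_sum_def op_apply_sum cinner_sum_right ket_apply cinner_scaleC_right of_real_sum
            complex_norm_square cinner_commute[of x])
      then have "(\<Sum>y<N. Re (cinner (k y \<cdot> \<psi>) (ket_sum e n \<cdot> k y \<cdot> \<psi>))) =
          (\<Sum>y<N. \<Sum>i<n. (cmod (h y (e i, \<psi>)))\<^sup>2)"
        by (simp only: k Re_complex_of_real)
      also have "\<dots> = (\<Sum>i<n. \<Sum>y<N. (cmod (h y (e i, \<psi>)))\<^sup>2)"
        by (rule sum.swap)
      also have "\<dots> \<le> (\<Sum>i<n. Re (choi_kernel T (e i, \<psi>) (e i, \<psi>)))"
        by (intro sum_mono h_sum_le)
      also have "\<dots> = Re (cinner \<psi> (T (ket_sum e n) \<cdot> \<psi>))"
        by (simp add: choi_kernel_def ket_sum_def T_lin op_apply_sum cinner_sum_right)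
      also have "\<dots> \<le> t \<psi>"
        unfolding t_def
      proof (rule completely_positive_mono[OF T])
        fix \<phi>
        have "Re (cinner \<phi> (ket_sum e n \<cdot> \<phi>)) \<le> norm \<phi> * norm (ket_sum e n \<cdot> \<phi>)"
          by (metis inner_eq_Re_cinner norm_cauchy_schwarz)
        also have "\<dots> \<le> norm \<phi> * norm \<phi>"
          by (intro mult_left_mono P_contr) simp
        finally have "Re (cinner \<phi> (ket_sum e n \<cdot> \<phi>)) \<le> (norm \<phi>)\<^sup>2"
          by (simp add: power2_eq_square)
        moreover have "Im (cinner \<phi> (ket_sum e n \<cdot> \<phi>)) = 0"
          using cinner_self_adjoint_real[OF P_adj, of \<phi> n] by (metis Im_complex_of_real)
        ultimately show "cinner \<phi> ((1 - ket_sum e n) \<cdot> \<phi>) \<in> \<real>\<^sub>\<ge>\<^sub>0"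
          by (simp add: cinner_simps cinner_self complex_nonneg_Reals_iff flip: of_real_power)
      qed
      finally show ?thesis .
    qed
    then show "\<exists>N'. \<forall>n\<ge>N'. (\<Sum>y<N. Re (cinner (k y \<cdot> \<psi>) (ket_sum e n \<cdot> k y \<cdot> \<psi>))) \<le> t \<psi>"
      by blast
  qed
  have k_prod_le: "(\<Sum>y<N. norm (k y \<cdot> \<phi>) * norm (k y \<cdot> \<psi>)) \<le> C\<^sup>2 * norm \<phi> * norm \<psi>" for N \<phi> \<psi>
  proof -
    have L2: "L2_set (\<lambda>y. norm (k y \<cdot> \<psi>)) {..<N} \<le> C * norm \<psi>" for \<psi>
      unfolding L2_set_def using order_trans[OF k_sum_le C(2), of \<psi> N] C(1)
      by (intro real_le_lsqrt) (simp_all add: sum_nonneg power_mult_distrib)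
    have "(\<Sum>y<N. \<bar>norm (k y \<cdot> \<phi>)\<bar> * \<bar>norm (k y \<cdot> \<psi>)\<bar>) \<le>
        L2_set (\<lambda>y. norm (k y \<cdot> \<phi>)) {..<N} * L2_set (\<lambda>y. norm (k y \<cdot> \<psi>)) {..<N}"
      by (rule L2_set_mult_ineq)
    also have "\<dots> \<le> (C * norm \<phi>) * (C * norm \<psi>)"
      using C(1) by (intro mult_mono L2) auto
    finally show ?thesis
      by (simp add: power2_eq_square mult_ac)
  qed
  have k_prod_summable: "summable (\<lambda>y. norm (k y \<cdot> \<phi>) * norm (k y \<cdot> \<psi>))" for \<phi> \<psi>
    by (rule summableI_nonneg_bounded[OF _ k_prod_le]) simp
  show thesis
  proof (rule that)
    fix a :: "'h bdd_op"
    obtain K where K: "0 < K" "\<And>x. norm (a \<cdot> x) \<le> K * norm x"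
      using op_bounded by blast
    have term_le: "norm (cinner (k y \<cdot> \<phi>) (a \<cdot> k y \<cdot> \<psi>)) \<le> K * (norm (k y \<cdot> \<phi>) * norm (k y \<cdot> \<psi>))" for y \<phi> \<psi>
      using order_trans[OF norm_cinner_le mult_left_mono[OF K(2) norm_ge_zero]] by (simp add: mult_ac)
    have abs_summable: "summable (\<lambda>y. norm (cinner (k y \<cdot> \<phi>) (a \<cdot> k y \<cdot> \<psi>)))" for \<phi> \<psi>
      by (rule summable_comparison_test'[OF summable_mult[OF k_prod_summable[of \<phi> \<psi>], of K]])
        (simp only: real_norm_def abs_norm_cancel term_le)
    \<comment> \<open>The defect of the Kraus formula: bounded, additive in \<open>\<psi>\<close>,
      and zero at every \<open>d m\<close>, hence zero by density.\<close>
    define D where "D \<phi> \<psi> = (\<Sum>y. cinner (k y \<cdot> \<phi>) (a \<cdot> k y \<cdot> \<psi>)) - cinner \<phi> (T a \<cdot> \<psi>)" for \<phi> \<psi>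
    define F where "F n = ket_sum e n * a * ket_sum e n" for n
    have F_le: "norm (F n \<cdot> x) \<le> K * norm x" for n x
      using order_trans[OF P_contr order_trans[OF K(2) mult_left_mono[OF P_contr]]] K(1) by (simp add: F_def)
    have F_lim: "(\<lambda>n. F n \<cdot> x) \<longlonglongrightarrow> a \<cdot> x" for x
    proof -
      have "(\<lambda>n. ket_sum e n \<cdot> (a \<cdot> ket_sum e n \<cdot> x - a \<cdot> x)) \<longlonglongrightarrow> 0"
      proof (rule Lim_null_comparison)
        show "\<forall>\<^sub>F n in sequentially. norm (ket_sum e n \<cdot> (a \<cdot> ket_sum e n \<cdot> x - a \<cdot> x)) \<le>
            norm (a \<cdot> ket_sum e n \<cdot> x - a \<cdot> x)"
          using P_contr by simp
        show "(\<lambda>n. norm (a \<cdot> ket_sum e n \<cdot> x - a \<cdot> x)) \<longlonglongrightarrow> 0"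
          using tendsto_op_apply[OF P_lim, of a x] by (simp add: tendsto_norm_zero_iff LIM_zero_iff)
      qed
      from tendsto_add[OF this P_lim[of "a \<cdot> x"]] show ?thesis
        by (simp add: op_apply_diff_right F_def)
    qed
    have F_sum: "(\<Sum>y. cinner (k y \<cdot> \<phi>) (F n \<cdot> k y \<cdot> d m)) = cinner \<phi> (T (F n) \<cdot> d m)" for n m \<phi>
    proof -
      \<comment> \<open>The sum is a convenient upper bound for the finitely many pivot indices of
        \<open>(e j, d m)\<close> with \<open>j < n\<close>. From \<open>N\<close> on all these
        columns are cleared, so the partial sums are constant.\<close>
      define N where "N = Suc (\<Sum>j<n. prod_encode (j, m))"
      have pivot: "choi_kernel T (e i, \<phi>) (e j, d m) = (\<Sum>y<M. cnj (h y (e i, \<phi>)) * h y (e j, d m))"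
        if "j < n" "N \<le> M" for i j M
      proof -
        have "prod_encode (j, m) \<le> (\<Sum>j<n. prod_encode (j, m))"
          using that(1) by (intro member_le_sum) auto
        then have "prod_encode (j, m) < M"
          using that(2) by (simp add: N_def)
        from h_pivot[OF this, of "(e i, \<phi>)"] show ?thesis
          by (simp add: p_def)
      qed
      have "(\<Sum>y<M. cinner (k y \<cdot> \<phi>) (F n \<cdot> k y \<cdot> d m)) = cinner \<phi> (T (F n) \<cdot> d m)" if "N \<le> M" for M
      proof -
        have k_left: "cinner (k y \<cdot> \<phi>) (e i) = cnj (h y (e i, \<phi>))" for y i
          by (simp add: cinner_commute[of _ "e i"] k)
        have "cinner \<phi> (T (F n) \<cdot> d m) =
            (\<Sum>i<n. \<Sum>j<n. cinner (e i) (a \<cdot> e j) * choi_kernel T (e i, \<phi>) (e j, d m))"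
          by (simp add: F_def ket_sum_sandwich T_lin op_apply_sum cinner_sum_right cinner_scaleC_right choi_kernel_def)
        also have "\<dots> = (\<Sum>i<n. \<Sum>j<n. \<Sum>y<M.
            cinner (e i) (a \<cdot> e j) * (cnj (h y (e i, \<phi>)) * h y (e j, d m)))"
          by (intro sum.cong refl) (simp add: pivot[OF _ that] flip: sum_distrib_left)
        also have "\<dots> = (\<Sum>i<n. \<Sum>y<M. \<Sum>j<n.
            cinner (e i) (a \<cdot> e j) * (cnj (h y (e i, \<phi>)) * h y (e j, d m)))"
          by (intro sum.cong refl sum.swap)
        also have "\<dots> = (\<Sum>y<M. \<Sum>i<n. \<Sum>j<n.
            cinner (e i) (a \<cdot> e j) * (cnj (h y (e i, \<phi>)) * h y (e j, d m)))"
          by (rule sum.swap)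
        also have "\<dots> = (\<Sum>y<M. cinner (k y \<cdot> \<phi>) (F n \<cdot> k y \<cdot> d m))"
          unfolding F_def ket_sum_sandwich
          by (simp add: op_apply_sum cinner_sum_right cinner_scaleC_right k k_left mult_ac)
        finally show ?thesis ..
      qed
      then have "\<forall>\<^sub>F M in sequentially. (\<Sum>y<M. cinner (k y \<cdot> \<phi>) (F n \<cdot> k y \<cdot> d m)) = cinner \<phi> (T (F n) \<cdot> d m)"
        unfolding eventually_sequentially by blast
      then have "(\<lambda>y. cinner (k y \<cdot> \<phi>) (F n \<cdot> k y \<cdot> d m)) sums cinner \<phi> (T (F n) \<cdot> d m)"
        unfolding sums_def by (rule tendsto_eventually)
      then show ?thesis by (rule sums_unique[symmetric])
    qed
    have D_dense: "D \<phi> (d m) = 0" for \<phi> m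
    proof -
      have "(\<lambda>n. \<Sum>y. cinner (k y \<cdot> \<phi>) (F n \<cdot> k y \<cdot> d m)) \<longlonglongrightarrow> (\<Sum>y. cinner (k y \<cdot> \<phi>) (a \<cdot> k y \<cdot> d m))"
        by (rule tendsto_suminf_cinner[OF k_prod_summable F_le F_lim])
      moreover have "(\<lambda>n. cinner \<phi> (T (F n) \<cdot> d m)) \<longlonglongrightarrow> cinner \<phi> (T a \<cdot> d m)"
        by (rule normal_map_tendsto[OF normal F_le F_lim])
      ultimately show ?thesis
        unfolding F_sum D_def using LIMSEQ_unique by fastforce
    qed
    have D_diff: "D \<phi> \<psi> - D \<phi> \<theta> = D \<phi> (\<psi> - \<theta>)" for \<phi> \<psi> \<theta>
      using suminf_diff[OF summable_norm_cancel[OF abs_summable] summable_norm_cancel[OF abs_summable], of \<phi> \<psi> \<phi> \<theta>]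
      by (simp add: D_def op_apply_diff_right cinner_simps)
    obtain K' where K': "0 < K'" "\<And>x. norm (T a \<cdot> x) \<le> K' * norm x"
      using op_bounded by blast
    have D_le: "cmod (D \<phi> \<psi>) \<le> (K * C\<^sup>2 + K') * norm \<phi> * norm \<psi>" for \<phi> \<psi>
    proof -
      have "cmod (\<Sum>y. cinner (k y \<cdot> \<phi>) (a \<cdot> k y \<cdot> \<psi>)) \<le> (\<Sum>y. norm (cinner (k y \<cdot> \<phi>) (a \<cdot> k y \<cdot> \<psi>)))"
        by (rule summable_norm[OF abs_summable])
      also have "\<dots> \<le> (\<Sum>y. K * (norm (k y \<cdot> \<phi>) * norm (k y \<cdot> \<psi>)))"
        by (intro suminf_le term_le abs_summable summable_mult k_prod_summable)
      also have "\<dots> = K * (\<Sum>y. norm (k y \<cdot> \<phi>) * norm (k y \<cdot> \<psi>))"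
        by (rule suminf_mult[OF k_prod_summable])
      also have "\<dots> \<le> K * (C\<^sup>2 * norm \<phi> * norm \<psi>)"
        using K(1) by (intro mult_left_mono suminf_le_const k_prod_summable k_prod_le) simp
      finally have "cmod (\<Sum>y. cinner (k y \<cdot> \<phi>) (a \<cdot> k y \<cdot> \<psi>)) \<le> K * (C\<^sup>2 * norm \<phi> * norm \<psi>)" .
      moreover have "cmod (cinner \<phi> (T a \<cdot> \<psi>)) \<le> norm \<phi> * (K' * norm \<psi>)"
        by (rule order_trans[OF norm_cinner_le mult_left_mono[OF K'(2) norm_ge_zero]])
      ultimately show ?thesis
        unfolding D_def
        using norm_triangle_ineq4[of "\<Sum>y. cinner (k y \<cdot> \<phi>) (a \<cdot> k y \<cdot> \<psi>)" "cinner \<phi> (T a \<cdot> \<psi>)"]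
        by (simp add: algebra_simps)
    qed
    have D_zero: "D \<phi> \<psi> = 0" for \<phi> \<psi>
    proof (rule ccontr)
      assume "D \<phi> \<psi> \<noteq> 0"
      define B where "B = (K * C\<^sup>2 + K') * norm \<phi> + 1"
      have "0 < B"
        using K(1) K'(1) by (simp add: B_def add_nonneg_pos)
      then obtain m where m: "norm (\<psi> - d m) < cmod (D \<phi> \<psi>) / B"
        using d[of "cmod (D \<phi> \<psi>) / B" \<psi>] \<open>D \<phi> \<psi> \<noteq> 0\<close> by auto
      have "cmod (D \<phi> \<psi>) = cmod (D \<phi> (\<psi> - d m))"
        using D_diff[of \<phi> \<psi> "d m"] by (simp add: D_dense)
      also have "\<dots> \<le> (K * C\<^sup>2 + K') * norm \<phi> * norm (\<psi> - d m)"
        by (rule D_le)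
      also have "\<dots> \<le> B * norm (\<psi> - d m)"
        by (intro mult_right_mono) (simp_all add: B_def)
      also have "\<dots> < cmod (D \<phi> \<psi>)"
        using m \<open>0 < B\<close> by (simp add: pos_less_divide_eq mult.commute)
      finally show False by simp
    qed
    show "op_has_sum (\<lambda>y. adj (k y) * a * k y) (T a) UNIV"
      unfolding op_has_sum_def
    proof (intro allI)
      fix \<phi> \<psi>
      have "(\<lambda>y. cinner (k y \<cdot> \<phi>) (a \<cdot> k y \<cdot> \<psi>)) sums cinner \<phi> (T a \<cdot> \<psi>)"
        using D_zero[of \<phi> \<psi>] summable_sums[OF summable_norm_cancel[OF abs_summable[of \<phi> \<psi>]]]
        by (simp add: D_def)
      from norm_summable_imp_has_sum[OF abs_summable this]
      show "((\<lambda>y. cinner \<phi> ((adj (k y) * a * k y) \<cdot> \<psi>)) has_sum cinner \<phi> (T a \<cdot> \<psi>)) UNIV"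
        by (simp add: cinner_adj_right)
    qed
  qed
qed

subsection \<open>Module maps and duality\<close>

text \<open>
  For a unitary \<open>w \<in> N\<close> the operators \<open>(1 \<plusminus> w) / 2\<close> form an \<open>N\<close>-inner instrument. Polarizing over
  \<open>w = \<plusminus> u, \<plusminus> \<i> u\<close> turns commutation with these instruments into the module property.
\<close>

lemma commuting_imp_module_map:
  fixes T :: "'h::complex_hilbert bdd_op \<Rightarrow> 'h bdd_op"
  assumes T: "completely_positive T" and N: "star_subalgebra N" "1 \<in> N"
    and commute: "\<And>Y S y. inner_instrument N Y S \<Longrightarrow> y \<in> Y \<Longrightarrow> T \<circ> S y = S y \<circ> T"
    and u: "u \<in> N" "unitary u"
  shows "T (a * u) = T a * u"
proof -
  note T_lin = completely_positive_linear[OF T]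
  have N_add: "a + b \<in> N" and N_scale: "c *\<^sub>C a \<in> N" if "a \<in> N" "b \<in> N" for a b c
    using N(1) that by (auto simp: star_subalgebra_def)
  define Q where "Q w a = (1 + adj w) * a * (1 + w)" for w a :: "'h bdd_op"
  have TQ: "T (Q w a) = Q w (T a)" if w: "w \<in> N" "unitary w" for w a
  proof -
    define k where "k x = (1/2) *\<^sub>C (if x = 0 then 1 + w else 1 + (-1) *\<^sub>C w)" for x :: nat
    have quarter: "(1/4::complex) *\<^sub>C v + (1/4) *\<^sub>C v + ((1/4) *\<^sub>C v + (1/4) *\<^sub>C v) = v" for v :: "'h bdd_op"
      by (simp flip: scaleC_add_left add: scaleC_one)
    have "adj (k 0) * k 0 + adj (k 1) * k 1 = 1"
      using w(2) quarter[of 1]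
      by (simp add: k_def unitary_def adj_scaleC adj_add adj_diff algebra_simps scaleC_scaleC scaleC_minus_left
          scaleC_one scaleC_add_right scaleC_diff_right)
    then have "inner_instrument N {0, 1} (\<lambda>x a. adj (k x) * a * k x)"
      using w N(2) by (intro inner_instrument_conjugations) (auto simp: k_def intro!: N_scale N_add)
    from commute[OF this, of 0] have "T (adj (k 0) * a * k 0) = adj (k 0) * T a * k 0"
      by (auto dest: fun_cong[of _ _ a])
    moreover have "adj (k 0) * v * k 0 = (1/4) *\<^sub>C Q w v" for v
      by (simp add: k_def Q_def adj_scaleC adj_add scaleC_scaleC)
    ultimately have "(1/4) *\<^sub>C T (Q w a) = (1/4) *\<^sub>C Q w (T a)"
      by (simp add: T_lin)
    then have "4 *\<^sub>C (1/4) *\<^sub>C T (Q w a) = 4 *\<^sub>C (1/4) *\<^sub>C Q w (T a)"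
      by simp
    then show ?thesis
      by (simp add: scaleC_scaleC scaleC_one)
  qed
  have phase: "c *\<^sub>C u \<in> N" "unitary (c *\<^sub>C u)" if "cnj c * c = 1" for c
    using u that N_scale[OF u(1) u(1)]
    by (simp_all add: unitary_def adj_scaleC scaleC_scaleC scaleC_one mult.commute)
  have polar: "4 *\<^sub>C (v * u) = Q (1 *\<^sub>C u) v - Q ((-1) *\<^sub>C u) v - \<i> *\<^sub>C (Q (\<i> *\<^sub>C u) v - Q ((-\<i>) *\<^sub>C u) v)" for v
  proof -
    have four: "4 *\<^sub>C z = z + z + (z + z)" for z :: "'h bdd_op"
      using scaleC_add_left[of 2 2 z] by (simp add: scaleC_two)
    show ?thesis
      by (simp add: Q_def four algebra_simps adj_scaleC adj_minus scaleC_scaleC scaleC_minus_left scaleC_one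
          scaleC_minus_right scaleC_add_right scaleC_diff_right)
  qed
  have "4 *\<^sub>C T (a * u) = T (4 *\<^sub>C (a * u))"
    by (simp add: T_lin)
  also have "\<dots> = 4 *\<^sub>C (T a * u)"
    unfolding polar by (simp only: T_lin TQ[OF phase] complex_cnj_one complex_cnj_minus complex_cnj_i) (simp add: T_lin TQ phase)
  finally have "(1/4) *\<^sub>C 4 *\<^sub>C T (a * u) = (1/4) *\<^sub>C 4 *\<^sub>C (T a * u)"
    by simp
  then show ?thesis
    by (simp add: scaleC_scaleC scaleC_one)
qed

text \<open>The squared norms of \<open>(k y * u - u * k y) \<cdot> \<psi>\<close> expand into four
  series, summed by the values of \<open>T\<close> at \<open>1\<close>, \<open>u\<close> and
  \<open>adj u\<close>. The module property makes the total zero, so every term vanishes.\<close>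

lemma kraus_operators_commute:
  fixes k :: "nat \<Rightarrow> 'h::complex_hilbert bdd_op"
  assumes k: "\<And>a. op_has_sum (\<lambda>y. adj (k y) * a * k y) (T a) UNIV"
    and module: "\<And>a. T (a * u) = T a * u" and u: "unitary u"
  shows "k y * u = u * k y"
proof (rule bdd_op_eqI)
  fix \<psi>
  have sums: "(\<lambda>y. cinner (k y \<cdot> \<phi>) (a \<cdot> k y \<cdot> \<theta>)) sums cinner \<phi> (T a \<cdot> \<theta>)" for \<phi> \<theta> a
    using k[of a] by (intro has_sum_imp_sums) (simp add: op_has_sum_def cinner_adj_right)
  have uu: "adj u \<cdot> u \<cdot> x = x" for x
    using u unfolding unitary_def by (metis op_apply_simps(4,6))
  have T_u: "T u \<cdot> \<psi> = T 1 \<cdot> u \<cdot> \<psi>" "T (adj u) \<cdot> u \<cdot> \<psi> = T 1 \<cdot> \<psi>"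
    using module[of 1] module[of "adj u"] u by (simp_all add: unitary_def flip: op_apply_simps(4))
  define f where "f y = k y \<cdot> u \<cdot> \<psi> - u \<cdot> k y \<cdot> \<psi>" for y
  have "(\<lambda>y. cinner (k y \<cdot> u \<cdot> \<psi>) (1 \<cdot> k y \<cdot> u \<cdot> \<psi>) - cinner (k y \<cdot> u \<cdot> \<psi>) (u \<cdot> k y \<cdot> \<psi>) -
      (cinner (k y \<cdot> \<psi>) (adj u \<cdot> k y \<cdot> u \<cdot> \<psi>) - cinner (k y \<cdot> \<psi>) (1 \<cdot> k y \<cdot> \<psi>))) sums
      (cinner (u \<cdot> \<psi>) (T 1 \<cdot> u \<cdot> \<psi>) - cinner (u \<cdot> \<psi>) (T u \<cdot> \<psi>) -
      (cinner \<psi> (T (adj u) \<cdot> u \<cdot> \<psi>) - cinner \<psi> (T 1 \<cdot> \<psi>)))"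
    by (intro sums_diff sums)
  moreover have "cinner (k y \<cdot> u \<cdot> \<psi>) (1 \<cdot> k y \<cdot> u \<cdot> \<psi>) - cinner (k y \<cdot> u \<cdot> \<psi>) (u \<cdot> k y \<cdot> \<psi>) -
      (cinner (k y \<cdot> \<psi>) (adj u \<cdot> k y \<cdot> u \<cdot> \<psi>) - cinner (k y \<cdot> \<psi>) (1 \<cdot> k y \<cdot> \<psi>)) = cinner (f y) (f y)" for y
    using cinner_adj_right[of "k y \<cdot> \<psi>" u "u \<cdot> k y \<cdot> \<psi>"]
    by (simp add: f_def cinner_simps cinner_adj_right uu)
  ultimately have "(\<lambda>y. cinner (f y) (f y)) sums 0"
    by (simp add: T_u)
  from sums_Re[OF this] have "(\<lambda>y. (norm (f y))\<^sup>2) sums 0"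
    by (simp add: cinner_self flip: of_real_power)
  then have "\<forall>y. (norm (f y))\<^sup>2 = 0"
    using suminf_eq_zero_iff[of "\<lambda>y. (norm (f y))\<^sup>2"] by (simp add: sums_iff)
  then show "(k y * u) \<cdot> \<psi> = (u * k y) \<cdot> \<psi>"
    by (simp add: f_def)
qed

lemma can_implement_commuting_commutant:
  fixes N :: "'h::complex_hilbert bdd_op set"
  assumes sep: "separable_space (euclidean :: 'h topology)" and N: "von_neumann_algebra N"
  shows "can_implement_commuting (commutant N) N"
  unfolding can_implement_commuting_def
proof (intro allI impI)
  fix X and T :: "nat \<Rightarrow> 'h bdd_op \<Rightarrow> 'h bdd_op"
  assume *: "instrument X T \<and> (\<forall>Y S. inner_instrument N Y S \<longrightarrow> instruments_commute X T Y S)"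
  have N_star: "star_subalgebra N" and one: "1 \<in> N" and NN: "commutant (commutant N) = N"
    using N commutant_one[of "commutant N"] by (auto simp: von_neumann_algebra_def)
  have "\<exists>(Y :: nat set) k. (\<forall>y\<in>Y. k y \<in> commutant N) \<and>
      (\<forall>a. op_has_sum (\<lambda>y. adj (k y) * a * k y) (T x a) Y)" if x: "x \<in> X" for x
  proof -
    have T: "completely_positive (T x)" "normal_map (T x)"
      using * x by (auto simp: instrument_def)
    obtain k where k: "\<And>a. op_has_sum (\<lambda>y. adj (k y) * a * k y) (T x a) (UNIV :: nat set)"
      using kraus_decomposition[OF sep T] by blast
    have commute: "T x \<circ> S y = S y \<circ> T x" if "inner_instrument N Y S" "y \<in> Y" for Y S y
      using * x that unfolding instruments_commute_def by blast
    have module: "T x (a * u) = T x a * u" if "u \<in> N" "unitary u" for u a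
      using T(1) N_star one commute that by (rule commuting_imp_module_map[where T = "T x"])
    have "k y \<in> commutant N" for y
    proof -
      \<comment> \<open>Being a double commutant, \<open>N\<close> is spanned by its unitaries, so
        commuting with those suffices.\<close>
      have "b * k y = k y * b" if "b \<in> commutant (commutant N)" for b
        using commutant_adj[OF von_neumann_algebraD(1)[OF N]] that
      proof (rule commutant_unitary_induct)
        show "u * k y = k y * u" if "u \<in> commutant (commutant N)" "unitary u" for u
          using kraus_operators_commute[where T = "T x", OF k module] that by (simp add: NN)
      qed (simp_all add: distrib_left distrib_right)
      then show ?thesis
        unfolding NN by (simp add: commutant_def)
    qed
    then show ?thesis
      using k by blast
  qed
  then show "inner_instrument (commutant N) X T"
    using * by (simp add: inner_instrument_def)
qed

theorem theorem2:
  fixes M\<^sub>A M\<^sub>B :: "'h::complex_hilbert bdd_op set"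
  assumes "separable_space (euclidean :: 'h topology)"
    and "von_neumann_algebra M\<^sub>A" and "von_neumann_algebra M\<^sub>B"
    and "\<forall>a\<in>M\<^sub>A. \<forall>b\<in>M\<^sub>B. a * b = b * a"
  shows "(operational_duality M\<^sub>A M\<^sub>B \<longleftrightarrow> unique_purifications M\<^sub>A M\<^sub>B) \<and>
    (operational_duality M\<^sub>A M\<^sub>B \<and> unique_purifications M\<^sub>A M\<^sub>B \<longleftrightarrow> M\<^sub>A = commutant M\<^sub>B)"
proof -
  note A = von_neumann_algebraD[OF assms(2)] and B = von_neumann_algebraD[OF assms(3)]
  have AB: "M\<^sub>A \<subseteq> commutant M\<^sub>B" and BA: "M\<^sub>B \<subseteq> commutant M\<^sub>A"
    using assms(4) by (auto simp: commutant_def)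
  have "operational_duality M\<^sub>A M\<^sub>B \<and> unique_purifications M\<^sub>A M\<^sub>B" if "M\<^sub>A = commutant M\<^sub>B"
  proof -
    have "M\<^sub>B = commutant M\<^sub>A"
      using that B(2) by simp
    then show ?thesis
      using can_implement_commuting_commutant[OF assms(1,2)] can_implement_commuting_commutant[OF assms(1,3)]
        unique_purifications_commutant[OF assms(2)] that
      by (simp add: operational_duality_def)
  qed
  moreover have "M\<^sub>A = commutant M\<^sub>B" if "operational_duality M\<^sub>A M\<^sub>B"
    using can_implement_commuting_imp_commutant_subset[OF A(2) _ B(1)] assms(2) that AB
    unfolding operational_duality_def von_neumann_algebra_def by blast
  \<comment> \<open>The inclusion obtained is that of \<open>commutant M\<^sub>A\<close> in
    \<open>M\<^sub>B\<close>; with \<open>BA\<close> it is an equality, and one more commutant gives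
    the claim.\<close>
  moreover have "M\<^sub>A = commutant M\<^sub>B" if "unique_purifications M\<^sub>A M\<^sub>B"
    using unique_purifications_imp_commutant_subset[OF assms(2,3) that] BA A(2) by simp
  ultimately show ?thesis
    by blast
qed

end
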